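(* Let $p\in[1,\infty)$, let $N\ge1$ be a real number, and let $(X,d)$ be a compact metric space with $\mathcal{H}^N(X)<\infty$. Let $E,F\subset X$ be two disjoint, non-empty, compact, connected sets. Suppose that $u:X\to\mathbb{R}$ is in $N^{1,p}(X)$ with $u|_E=0$ and $u|_F=1$. Assume further that $u$ has a lower semicontinuous non-negative upper gradient $g\in L^p(X)$ and that there is an $\epsilon>0$ such that $g\ge\epsilon$ on $X$. Then there is a sequence of Lipschitz functions $u_i:X\to\mathbb{R}$ with $0\le u_i\le1$, $u_i|_E=0$, $u_i|_F=1$, such that each $u_i$ has a continuous local Lipschitz upper gradient $g_i$, and $g_i\to g$ in $L^p(X)$.
   Context: $X$ is equipped with the Hausdorff measure $\mathcal{H}^N$, and $L^p(X)$ refers to this measure. Normalization: $\mathcal{H}^N(A):=\lim_{\delta\to0}\frac{v_N}{2^N}\inf\{\sum_i\operatorname{diam}(A_i)^N:A\subset\bigcup_iA_i,\ \operatorname{diam}(A_i)<\delta\}$ over countable covers, with $v_N=\pi^{N/2}/\Gamma_{\mathrm{Eul}}(\frac N2+1)$, $\Gamma_{\mathrm{Eul}}$ the Gamma function. Upper gradients: for measurable $f:X\to[-\infty,\infty]$, a Borel function $g:X\to[0,\infty]$ is an upper gradient of $f$ if $\int_\gamma g\,ds\ge|f(\gamma(0))-f(\gamma(1))|$ for every rectifiable curve $\gamma:[0,1]\to X$ (with $|\infty-\infty|=\infty$). $N^{1,p}(X)$ is the set of $f\in L^p(X)$ (everywhere-defined functions) having an upper gradient in $L^p(X)$. Lipschitz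 constants: for $A\subset X$ and a Lipschitz function $f:X\to\mathbb{R}$, $\operatorname{LIP}[f](A):=\sup_{x,y\in A,\,x\ne y}\frac{|f(x)-f(y)|}{d(x,y)}$ (equal to $0$ if $A$ has at most one point). Local Lipschitz upper gradient: a function $g:X\to[0,\infty)$ is a local Lipschitz upper gradient for $f:X\to\mathbb{R}$ if for every $x\in X$ there exists $r_x>0$ such that for each $r\in(0,r_x)$, $\operatorname{LIP}[f](B(x,r))\le\sup_{y\in B(x,2r)}g(y)$, where $B(x,r)$ denotes the ball of radius $r$ centered at $x$. *)

theory Defs
  imports "HOL-Analysis.Analysis"
begin

section \<open>Hausdorff measure\<close>

text \<open>Sequences of sets encode all countable covers: finite ones are padded with \<open>{}\<close>, which
  contributes \<open>0 powr N = 0\<close>. Boundedness is required because \<^const>\<open>diameter\<close> is unspecified on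
  unbounded sets.\<close>

definition hausdorff_content :: "real \<Rightarrow> real \<Rightarrow> 'a::metric_space set \<Rightarrow> ennreal" where
  "hausdorff_content N \<delta> A =
     (INF C \<in> {C :: nat \<Rightarrow> 'a set. A \<subseteq> (\<Union>i. C i) \<and> (\<forall>i. bounded (C i) \<and> diameter (C i) < \<delta>)}.
        \<Sum>i. ennreal (diameter (C i) powr N))"

definition hausdorff_outer_measure :: "real \<Rightarrow> 'a::metric_space set \<Rightarrow> ennreal" where
  "hausdorff_outer_measure N A =
     Lim (at_right 0) (\<lambda>\<delta>. ennreal (unit_ball_vol N / 2 powr N) * hausdorff_content N \<delta> A)"

text \<open>The measure lives on the sigma-algebra of all Caratheodory-measurable sets, so it is complete.\<close>

definition hausdorff_measure :: "real \<Rightarrow> 'a::metric_space measure" where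
  "hausdorff_measure N =
     measure_of UNIV (lambda_system UNIV UNIV (hausdorff_outer_measure N)) (hausdorff_outer_measure N)"

lemma hausdorff_content_antimono:
  assumes "\<delta> \<le> \<epsilon>"
  shows "hausdorff_content N \<epsilon> A \<le> hausdorff_content N \<delta> A"
  unfolding hausdorff_content_def
  by (rule INF_superset_mono) (use assms in \<open>auto intro: less_le_trans\<close>)

lemma hausdorff_content_mono:
  assumes "A \<subseteq> B"
  shows "hausdorff_content N \<delta> A \<le> hausdorff_content N \<delta> B"
  unfolding hausdorff_content_def
  by (rule INF_superset_mono) (use assms in auto)

lemma hausdorff_content_empty:
  assumes "\<delta> > 0"
  shows "hausdorff_content N \<delta> ({} :: 'a::metric_space set) = 0"
proof -
  have "hausdorff_content N \<delta> ({} :: 'a set) \<le> (\<Sum>i. ennreal (diameter ((\<lambda>_::nat. {}::'a set) i) powr N))"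
    unfolding hausdorff_content_def
    by (rule INF_lower[where i = "\<lambda>_. {}"]) (use assms in auto)
  then show ?thesis by simp
qed

lemma hausdorff_content_UN_le:
  fixes A :: "nat \<Rightarrow> 'a::metric_space set"
  shows "hausdorff_content N \<delta> (\<Union>n. A n) \<le> (\<Sum>n. hausdorff_content N \<delta> (A n))"
proof (rule ennreal_le_epsilon)
  fix e :: real
  assume fin: "(\<Sum>n. hausdorff_content N \<delta> (A n)) < top" and "0 < e"
  have "\<exists>C. A n \<subseteq> (\<Union>i. C i) \<and> (\<forall>i. bounded (C i) \<and> diameter (C i) < \<delta>) \<and>
      (\<Sum>i. ennreal (diameter (C i) powr N)) \<le> hausdorff_content N \<delta> (A n) + ennreal (e * (1/2) ^ Suc n)"
    for n
  proof -
    have "hausdorff_content N \<delta> (A n) < hausdorff_content N \<delta> (A n) + ennreal (e * (1/2) ^ Suc n)"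
      using \<open>0 < e\<close> fin ennreal_suminf_lessD[of "\<lambda>n. hausdorff_content N \<delta> (A n)" top n]
      by (auto simp: less_top)
    then show ?thesis
      by (subst (asm) hausdorff_content_def) (auto simp: INF_less_iff intro: less_imp_le)
  qed
  then obtain C where C: "\<And>n. A n \<subseteq> (\<Union>i. C n i)" "\<And>n i. bounded (C n i)" "\<And>n i. diameter (C n i) < \<delta>"
    and Cs: "\<And>n. (\<Sum>i. ennreal (diameter (C n i) powr N))
                 \<le> hausdorff_content N \<delta> (A n) + ennreal (e * (1/2) ^ Suc n)"
    by metis
  let ?D = "case_prod C \<circ> prod_decode"
  have cover: "(\<Union>n. A n) \<subseteq> (\<Union>k. ?D k)"
  proof
    fix x assume "x \<in> (\<Union>n. A n)"
    then obtain n i where "x \<in> C n i" using C(1) by blast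
    then have "x \<in> ?D (prod_encode (n, i))" by simp
    then show "x \<in> (\<Union>k. ?D k)" by blast
  qed
  have "hausdorff_content N \<delta> (\<Union>n. A n) \<le> (\<Sum>k. ennreal (diameter (?D k) powr N))"
    unfolding hausdorff_content_def
    by (rule INF_lower) (use cover C(2,3) in \<open>auto simp: split_beta\<close>)
  also have "\<dots> = (\<Sum>n i. ennreal (diameter (C n i) powr N))"
  proof -
    have "(\<Sum>k. ennreal (diameter (?D k) powr N))
        = (\<Sum>k. ((\<lambda>(n, i). ennreal (diameter (C n i) powr N)) \<circ> prod_decode) k)"
      by (simp add: split_beta comp_def)
    also have "\<dots> = (\<Sum>n i. ennreal (diameter (C n i) powr N))"
      unfolding comp_def by (rule suminf_ennreal_2dimen) simp
    finally show ?thesis .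
  qed
  also have "\<dots> \<le> (\<Sum>n. hausdorff_content N \<delta> (A n) + ennreal (e * (1/2) ^ Suc n))"
    by (intro suminf_le Cs) auto
  also have "\<dots> = (\<Sum>n. hausdorff_content N \<delta> (A n)) + (\<Sum>n. ennreal (e * (1/2) ^ Suc n))"
    by (subst suminf_add) auto
  also have "(\<Sum>n. ennreal (e * (1/2) ^ Suc n)) = ennreal e"
    using sums_mult[OF power_half_series, of e] \<open>0 < e\<close>
    by (subst suminf_ennreal_eq[where x = e]) auto
  finally show "hausdorff_content N \<delta> (\<Union>n. A n) \<le> (\<Sum>n. hausdorff_content N \<delta> (A n)) + ennreal e" .
qed

lemma hausdorff_outer_measure_tendsto:
  "((\<lambda>\<delta>. ennreal (unit_ball_vol N / 2 powr N) * hausdorff_content N \<delta> A) \<longlongrightarrow>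
    (SUP \<delta>\<in>{0<..}. ennreal (unit_ball_vol N / 2 powr N) * hausdorff_content N \<delta> A)) (at_right 0)"
  (is "(?f \<longlongrightarrow> ?S) _")
proof (rule increasing_tendsto)
  show "\<forall>\<^sub>F \<delta> in at_right 0. ?f \<delta> \<le> ?S"
    by (auto simp: eventually_at_right_field intro!: exI[of _ 1] SUP_upper)
next
  fix x assume "x < ?S"
  then obtain \<delta> where "\<delta> > 0" "x < ?f \<delta>" by (auto simp: less_SUP_iff)
  then show "\<forall>\<^sub>F \<delta> in at_right 0. x < ?f \<delta>"
    unfolding eventually_at_right_field
    by (intro exI[of _ \<delta>])
       (auto elim!: less_le_trans intro!: mult_left_mono hausdorff_content_antimono)
qed

lemma hausdorff_outer_measure_eq_SUP:
  "hausdorff_outer_measure N A =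
     (SUP \<delta>\<in>{0<..}. ennreal (unit_ball_vol N / 2 powr N) * hausdorff_content N \<delta> A)"
  unfolding hausdorff_outer_measure_def
  by (rule tendsto_Lim[OF _ hausdorff_outer_measure_tendsto]) simp

lemma outer_measure_space_hausdorff:
  "outer_measure_space UNIV (hausdorff_outer_measure N :: 'a::metric_space set \<Rightarrow> ennreal)"
proof -
  let ?c = "ennreal (unit_ball_vol N / 2 powr N)"
  have "hausdorff_outer_measure N (\<Union>n. A n) \<le> (\<Sum>n. hausdorff_outer_measure N (A n))"
    for A :: "nat \<Rightarrow> 'a set"
  proof (subst hausdorff_outer_measure_eq_SUP, rule SUP_least)
    fix \<delta> :: real assume \<delta>: "\<delta> \<in> {0<..}"
    have "?c * hausdorff_content N \<delta> (\<Union>n. A n) \<le> ?c * (\<Sum>n. hausdorff_content N \<delta> (A n))"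
      by (intro mult_left_mono hausdorff_content_UN_le) auto
    also have "\<dots> = (\<Sum>n. ?c * hausdorff_content N \<delta> (A n))" by simp
    also have "\<dots> \<le> (\<Sum>n. hausdorff_outer_measure N (A n))"
      unfolding hausdorff_outer_measure_eq_SUP
      by (intro suminf_le SUP_upper \<delta>) auto
    finally show "?c * hausdorff_content N \<delta> (\<Union>n. A n) \<le> (\<Sum>n. hausdorff_outer_measure N (A n))" .
  qed
  moreover have "hausdorff_outer_measure N A \<le> hausdorff_outer_measure N B" if "A \<subseteq> B"
    for A B :: "'a set"
    unfolding hausdorff_outer_measure_eq_SUP
    by (intro SUP_mono' mult_left_mono hausdorff_content_mono that) auto
  moreover have "hausdorff_outer_measure N ({} :: 'a set) = 0"
    unfolding hausdorff_outer_measure_eq_SUP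
    by (auto simp: hausdorff_content_empty)
  ultimately show ?thesis
    by (auto simp: outer_measure_space_def positive_def increasing_def countably_subadditive_def)
qed

lemma measure_space_hausdorff:
  "measure_space UNIV (lambda_system UNIV UNIV (hausdorff_outer_measure N))
     (hausdorff_outer_measure N :: 'a::metric_space set \<Rightarrow> ennreal)"
  using sigma_algebra.caratheodory_lemma[OF sigma_algebra_Pow, of UNIV "hausdorff_outer_measure N"]
    outer_measure_space_hausdorff[of N]
  by simp

lemma space_hausdorff_measure [simp]: "space (hausdorff_measure N) = UNIV"
  by (simp add: hausdorff_measure_def space_measure_of_conv)

lemma sets_hausdorff_measure:
  "sets (hausdorff_measure N :: 'a::metric_space measure) =
     lambda_system UNIV UNIV (hausdorff_outer_measure N)"
  unfolding hausdorff_measure_def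
  using measure_space_hausdorff[of N, where 'a = 'a]
  by (intro sigma_algebra.sets_measure_of_eq) (simp add: measure_space_def)

lemma emeasure_hausdorff_measure:
  fixes A :: "'a::metric_space set"
  assumes "A \<in> sets (hausdorff_measure N)"
  shows "emeasure (hausdorff_measure N) A = hausdorff_outer_measure N A"
  unfolding hausdorff_measure_def
  using measure_space_hausdorff[of N, where 'a = 'a] assms
  by (intro emeasure_measure_of_sigma) (auto simp: measure_space_def sets_hausdorff_measure)


section \<open>Lebesgue spaces of extended real functions\<close>

definition ennpowr :: "ennreal \<Rightarrow> real \<Rightarrow> ennreal" where
  "ennpowr x p = (if x = \<infinity> then \<infinity> else ennreal (enn2real x powr p))"

definition Lp_norm :: "'a measure \<Rightarrow> real \<Rightarrow> ('a \<Rightarrow> ereal) \<Rightarrow> ennreal" where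
  "Lp_norm M p f = ennpowr (\<integral>\<^sup>+x. ennpowr (e2ennreal \<bar>f x\<bar>) p \<partial>M) (1 / p)"

definition Lp_space :: "'a measure \<Rightarrow> real \<Rightarrow> ('a \<Rightarrow> ereal) set" where
  "Lp_space M p = {f \<in> borel_measurable M. Lp_norm M p f < \<infinity>}"

definition tendsto_Lp :: "'a measure \<Rightarrow> real \<Rightarrow> (nat \<Rightarrow> 'a \<Rightarrow> ereal) \<Rightarrow> ('a \<Rightarrow> ereal) \<Rightarrow> bool" where
  "tendsto_Lp M p f g \<longleftrightarrow>
     (\<forall>i. f i \<in> Lp_space M p) \<and> g \<in> Lp_space M p \<and>
     (\<lambda>i. Lp_norm M p (\<lambda>x. f i x - g x)) \<longlonglongrightarrow> 0"


section \<open>Curves and upper gradients\<close>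

definition curve_length :: "(real \<Rightarrow> 'a::metric_space) \<Rightarrow> real \<Rightarrow> real \<Rightarrow> ennreal" where
  "curve_length \<gamma> a b =
     (SUP (n, t) \<in> {(n :: nat, t :: nat \<Rightarrow> real). mono_on {..n} t \<and> t 0 = a \<and> t n = b}.
        \<Sum>i<n. ennreal (dist (\<gamma> (t i)) (\<gamma> (t (Suc i)))))"

definition rectifiable :: "(real \<Rightarrow> 'a::metric_space) \<Rightarrow> bool" where
  "rectifiable \<gamma> \<longleftrightarrow> path \<gamma> \<and> curve_length \<gamma> 0 1 < \<infinity>"

text \<open>The arc-length parametrization is the map \<open>\<sigma>\<close> with \<open>\<sigma> (length of \<gamma> on [0,t]) = \<gamma> t\<close>. The
  parameter \<open>t\<close> picked by \<^const>\<open>inv_into\<close> is irrelevant, since a curve is constant between two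
  parameters with the same length.\<close>

definition arclength_param :: "(real \<Rightarrow> 'a::metric_space) \<Rightarrow> real \<Rightarrow> 'a" where
  "arclength_param \<gamma> s = \<gamma> (inv_into {0..1} (\<lambda>t. enn2real (curve_length \<gamma> 0 t)) s)"

definition curve_integral :: "('a::metric_space \<Rightarrow> ereal) \<Rightarrow> (real \<Rightarrow> 'a) \<Rightarrow> ennreal" where
  "curve_integral g \<gamma> =
     (\<integral>\<^sup>+s \<in> {0..enn2real (curve_length \<gamma> 0 1)}. e2ennreal (g (arclength_param \<gamma> s)) \<partial>lborel)"

text \<open>In \<^typ>\<open>ereal\<close> one has \<open>\<infinity> - \<infinity> = \<infinity>\<close> and \<open>-\<infinity> - (-\<infinity>) = \<infinity>\<close>, which is the convention wanted here.\<close>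

definition upper_gradient :: "('a::metric_space \<Rightarrow> ereal) \<Rightarrow> ('a \<Rightarrow> ereal) \<Rightarrow> bool" where
  "upper_gradient g f \<longleftrightarrow>
     g \<in> borel_measurable borel \<and> (\<forall>x. 0 \<le> g x) \<and>
     (\<forall>\<gamma>. rectifiable \<gamma> \<longrightarrow> enn2ereal (curve_integral g \<gamma>) \<ge> \<bar>f (\<gamma> 0) - f (\<gamma> 1)\<bar>)"

definition newtonian :: "real \<Rightarrow> real \<Rightarrow> ('a::metric_space \<Rightarrow> ereal) set" where
  "newtonian N p =
     {f \<in> Lp_space (hausdorff_measure N) p.
        \<exists>g. upper_gradient g f \<and> g \<in> Lp_space (hausdorff_measure N) p}"

definition lower_semicontinuous :: "('a::topological_space \<Rightarrow> ereal) \<Rightarrow> bool" where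
  "lower_semicontinuous g \<longleftrightarrow> (\<forall>a. open {x. a < g x})"


section \<open>Lipschitz constants\<close>

text \<open>Extended suprema avoid junk values of suprema of unbounded sets of reals, and the empty
  supremum is \<open>0\<close>.\<close>

definition LIP :: "('a::metric_space \<Rightarrow> real) \<Rightarrow> 'a set \<Rightarrow> ennreal" where
  "LIP f A = (SUP (x, y) \<in> {(x, y). x \<in> A \<and> y \<in> A \<and> x \<noteq> y}. ennreal (\<bar>f x - f y\<bar> / dist x y))"

definition local_Lipschitz_upper_gradient ::
    "('a::metric_space \<Rightarrow> real) \<Rightarrow> ('a \<Rightarrow> real) \<Rightarrow> bool" where
  "local_Lipschitz_upper_gradient g f \<longleftrightarrow>
     (\<forall>x. 0 \<le> g x) \<and>
     (\<forall>x. \<exists>r0>0. \<forall>r. 0 < r \<and> r < r0 \<longrightarrow> LIP f (ball x r) \<le> (SUP y \<in> ball x (2 * r). ennreal (g y)))"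

end

theory Submission
  imports Defs
begin

text \<open>Write \<open>g\<close> as the increasing limit of Lipschitz functions \<open>h n \<ge> \<epsilon>\<close>. The candidate for \<open>u\<^sub>i\<close> at \<open>z\<close>
  is the infimum, truncated at 1, of \<open>\<Sum> h (x j) d (x j, x (j + 1))\<close> over chains of small steps from
  \<open>E\<close> to \<open>z\<close>; such a function has \<open>h\<close> as a local Lipschitz upper gradient for free. The point is that
  it is almost 1 on \<open>F\<close>: since \<open>h \<ge> \<epsilon>\<close>, chains from \<open>E\<close> to \<open>F\<close> of cost at most \<open>c < 1\<close> have bounded
  length, so as the steps shrink they subconverge to a rectifiable curve along which, by Fatou's
  lemma, \<open>g\<close> has integral at most \<open>c\<close>. This contradicts \<open>g\<close> being an upper gradient of \<open>u\<close>. Dividing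
  \<open>h\<close> by \<open>c\<close> makes the potential equal to 1 on \<open>F\<close>, and \<open>c\<close> is sent to 1.\<close>

section \<open>Borel sets are Hausdorff measurable\<close>

text \<open>A set of diameter below \<open>\<delta>\<close> cannot meet both \<open>A\<close> and
  \<open>B\<close>, so every cover admissible for the union splits into one family covering
  \<open>A\<close> and another covering \<open>B\<close>.\<close>

lemma hausdorff_content_separated:
  fixes A B :: "'a::metric_space set"
  assumes sep: "\<And>a b. a \<in> A \<Longrightarrow> b \<in> B \<Longrightarrow> \<delta> \<le> dist a b"
  shows "hausdorff_content N \<delta> A + hausdorff_content N \<delta> B \<le> hausdorff_content N \<delta> (A \<union> B)"
  unfolding hausdorff_content_def[of N \<delta> "A \<union> B"]
proof (rule INF_greatest)
  fix C :: "nat \<Rightarrow> 'a set"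
  assume "C \<in> {C. A \<union> B \<subseteq> (\<Union>i. C i) \<and> (\<forall>i. bounded (C i) \<and> diameter (C i) < \<delta>)}"
  then have cover: "A \<union> B \<subseteq> (\<Union>i. C i)" and bd: "\<And>i. bounded (C i)" and diam: "\<And>i. diameter (C i) < \<delta>"
    by auto
  \<comment> \<open>The existence of one admissible cover forces this; it makes the padding by
    \<open>{}\<close> in \<open>CA\<close> and \<open>CB\<close> admissible.\<close>
  have \<delta>: "0 < \<delta>"
    using diam[of 0] diameter_ge_0[OF bd[of 0]] by simp
  define CA where "CA i = (if C i \<inter> A = {} then {} else C i)" for i
  define CB where "CB i = (if C i \<inter> A = {} then C i else {})" for i
  have "x \<in> (\<Union>i. CA i)" if "x \<in> A" for x
    using that cover unfolding CA_def by fastforce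
  then have "hausdorff_content N \<delta> A \<le> (\<Sum>i. ennreal (diameter (CA i) powr N))"
    unfolding hausdorff_content_def by (intro INF_lower) (use bd diam \<delta> in \<open>auto simp: CA_def\<close>)
  moreover have "x \<in> (\<Union>i. CB i)" if x: "x \<in> B" for x
  proof -
    obtain i where i: "x \<in> C i" using x cover by auto
    have "C i \<inter> A = {}"
      using diameter_bounded_bound[OF bd[of i] _ i] diam[of i] sep[OF _ x] by fastforce
    then show ?thesis using i unfolding CB_def by auto
  qed
  then have "hausdorff_content N \<delta> B \<le> (\<Sum>i. ennreal (diameter (CB i) powr N))"
    unfolding hausdorff_content_def by (intro INF_lower) (use bd diam \<delta> in \<open>auto simp: CB_def\<close>)
  ultimately have "hausdorff_content N \<delta> A + hausdorff_content N \<delta> B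
    \<le> (\<Sum>i. ennreal (diameter (CA i) powr N)) + (\<Sum>i. ennreal (diameter (CB i) powr N))"
    by (rule add_mono)
  also have "\<dots> = (\<Sum>i. ennreal (diameter (CA i) powr N) + ennreal (diameter (CB i) powr N))"
    by (rule suminf_add) auto
  \<comment> \<open>For each \<open>i\<close> one of \<open>CA i\<close>, \<open>CB i\<close> is
    \<open>C i\<close> and the other is empty, contributing \<open>0 powr N = 0\<close>.\<close>
  also have "\<dots> = (\<Sum>i. ennreal (diameter (C i) powr N))"
    by (intro suminf_cong) (auto simp: CA_def CB_def)
  finally show "hausdorff_content N \<delta> A + hausdorff_content N \<delta> B \<le> (\<Sum>i. ennreal (diameter (C i) powr N))" .
qed

text \<open>The contents satisfy the inequality at every scale below \<open>r\<close>, and it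
  survives the limit of the scale to 0.\<close>

lemma hausdorff_outer_measure_separated:
  fixes A B :: "'a::metric_space set"
  assumes "0 < r" and sep: "\<And>a b. a \<in> A \<Longrightarrow> b \<in> B \<Longrightarrow> r \<le> dist a b"
  shows "hausdorff_outer_measure N A + hausdorff_outer_measure N B \<le> hausdorff_outer_measure N (A \<union> B)"
proof -
  let ?f = "\<lambda>A \<delta>. ennreal (unit_ball_vol N / 2 powr N) * hausdorff_content N \<delta> (A :: 'a set)"
  have lim: "(?f A \<longlongrightarrow> hausdorff_outer_measure N A) (at_right 0)" for A
    using hausdorff_outer_measure_tendsto[of N A] by (simp add: hausdorff_outer_measure_eq_SUP)
  have "?f A \<delta> + ?f B \<delta> \<le> ?f (A \<union> B) \<delta>" if "\<delta> < r" for \<delta>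
    unfolding distrib_left[symmetric]
    by (intro mult_left_mono hausdorff_content_separated) (use that sep in fastforce)+
  then have "\<forall>\<^sub>F \<delta> in at_right 0. ?f A \<delta> + ?f B \<delta> \<le> ?f (A \<union> B) \<delta>"
    using \<open>0 < r\<close> by (auto simp: eventually_at_right_field)
  then show ?thesis
    by (rule tendsto_le[OF _ lim tendsto_add[OF lim lim], rotated]) simp
qed

lemma suminf_tail_ennreal:
  fixes a :: "nat \<Rightarrow> ennreal"
  assumes "(\<Sum>k. a k) \<noteq> \<infinity>"
  shows "(\<lambda>n. \<Sum>k. a (k + n)) \<longlonglongrightarrow> 0"
proof -
  have "(\<lambda>n. (\<Sum>k. a k) - (\<Sum>k<n. a k)) \<longlonglongrightarrow> (\<Sum>k. a k) - (\<Sum>k. a k)"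
    using assms by (intro tendsto_diff_ennreal summable_LIMSEQ tendsto_const) auto
  moreover have "(\<Sum>k. a k) - (\<Sum>k<n. a k) = (\<Sum>k. a (k + n))" for n
  proof -
    have "(\<Sum>k. a k) = (\<Sum>k. a (k + n)) + (\<Sum>k<n. a k)"
      by (rule suminf_offset) auto
    moreover have "(\<Sum>k<n. a k) \<noteq> \<infinity>"
      using assms calculation by (metis ennreal_add_eq_top infinity_ennreal_def)
    ultimately show ?thesis by (simp add: ennreal_add_diff_cancel_right)
  qed
  ultimately show ?thesis using assms by simp
qed

text \<open>Caratheodory's criterion: the shells \<open>R k\<close> exhaust \<open>A - C\<close> outside a neighbourhood of \<open>C\<close>,
  and shells of the same parity are separated, so their measures form a convergent series.\<close>

lemma metric_outer_measure_closed:
  fixes m :: "'a::metric_space set \<Rightarrow> ennreal"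
  assumes om: "outer_measure_space UNIV m"
    and sep: "\<And>A B r. 0 < r \<Longrightarrow> (\<And>a b. a \<in> A \<Longrightarrow> b \<in> B \<Longrightarrow> r \<le> dist a b) \<Longrightarrow> m A + m B \<le> m (A \<union> B)"
    and C: "closed C"
  shows "C \<in> lambda_system UNIV UNIV m"
proof -
  have mono: "m A \<le> m B" if "A \<subseteq> B" for A B
    using om that by (auto simp: outer_measure_space_def increasing_def)
  have empty: "m {} = 0"
    using om by (auto simp: outer_measure_space_def positive_def)
  \<comment> \<open>\<open>countably_subadditive\<close> speaks of disjoint families only, so a
    general family is first made disjoint.\<close>
  have csub: "m (\<Union>n. D n) \<le> (\<Sum>n. m (D n))" for D :: "nat \<Rightarrow> 'a set"
  proof -
    have "m (\<Union>n. disjointed D n) \<le> (\<Sum>n. m (disjointed D n))"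
      using om disjoint_family_disjointed[of D]
      by (auto simp: outer_measure_space_def countably_subadditive_def)
    also have "\<dots> \<le> (\<Sum>n. m (D n))" by (intro suminf_le mono disjointed_subset) auto
    finally show ?thesis by (simp add: UN_disjointed_eq)
  qed
  have sub: "m (A \<union> B) \<le> m A + m B" for A B
  proof -
    have "m (A \<union> B) = m (\<Union>n. (if n = (0::nat) then A else if n = 1 then B else {}) :: 'a set)"
      by (rule arg_cong[of _ _ m]) (auto split: if_splits)
    also have "\<dots> \<le> (\<Sum>n. m (if n = (0::nat) then A else if n = 1 then B else {}))"
      by (rule csub)
    also have "\<dots> = (\<Sum>n<2. m (if n = (0::nat) then A else if n = 1 then B else {}))"
      by (rule suminf_finite) (auto simp: empty)
    also have "\<dots> = m A + m B" by (simp add: numeral_2_eq_2)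
    finally show ?thesis .
  qed
  \<comment> \<open>The empty set is treated apart because \<open>infdist x {}\<close> is 0 by
    default, which would make every \<open>D n\<close> empty.\<close>
  have key: "m (A \<inter> C) + m (A - C) \<le> m A" if fin: "m A \<noteq> \<infinity>" and ne: "C \<noteq> {}" for A
  proof -
    define D where "D n = {x \<in> A. 1 / real (Suc n) \<le> infdist x C}" for n
    define R where "R n = D (Suc n) - D n" for n
    have D_mono: "D n \<subseteq> D k" if "n \<le> k" for n k
    proof -
      have "1 / real (Suc k) \<le> 1 / real (Suc n)" using that by (simp add: frac_le)
      then show ?thesis by (auto simp: D_def)
    qed
    have lip: "infdist x C \<le> dist x y + infdist y C" for x y
      using infdist_triangle[of x C y] by simp
    have odd_even: "(\<Sum>k<n. m (R (2 * k + i))) \<le> m (\<Union>k<n. R (2 * k + i))" for n i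
    proof (induction n)
      case (Suc n)
      have "m (\<Union>k<n. R (2 * k + i)) + m (R (2 * n + i)) \<le> m ((\<Union>k<n. R (2 * k + i)) \<union> R (2 * n + i))"
      proof (cases n)
        case (Suc n')
        \<comment> \<open>The earlier shells lie in \<open>D ?j\<close>, while the new one has index
          \<open>Suc ?j\<close> and avoids \<open>D (Suc ?j)\<close>. The skipped shell
          \<open>R ?j\<close> of the other parity keeps them apart by the difference of the two
          radii.\<close>
        let ?j = "2 * n' + i + 1"
        show ?thesis
        proof (rule sep)
          show "0 < 1 / real (Suc ?j) - 1 / real (Suc (Suc ?j))" by (simp add: frac_less2)
        next
          fix a b assume a: "a \<in> (\<Union>k<n. R (2 * k + i))" and b: "b \<in> R (2 * n + i)"
          then obtain k where k: "k < n" "a \<in> R (2 * k + i)" by auto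
          then have "a \<in> D ?j"
            using D_mono[of "Suc (2 * k + i)" ?j] Suc by (auto simp: R_def)
          moreover have "b \<notin> D (Suc ?j)" "b \<in> A"
            using b Suc by (auto simp: R_def D_def)
          ultimately have "1 / real (Suc ?j) \<le> infdist a C" "infdist b C < 1 / real (Suc (Suc ?j))"
            by (auto simp: D_def)
          then show "1 / real (Suc ?j) - 1 / real (Suc (Suc ?j)) \<le> dist a b"
            using lip[of a b] by linarith
        qed
      qed (simp add: empty)
      then show ?case using Suc by (simp add: lessThan_Suc Un_commute add.commute) (meson add_left_mono order_trans)
    qed (simp add: empty)
    have half: "(\<Sum>k<n. m (R (2 * k + i))) \<le> m A" for n i
      by (rule order_trans[OF odd_even mono]) (auto simp: R_def D_def)
    have "(\<Sum>k<n. m (R k)) \<le> m A + m A" for n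
    proof -
      have "(\<Sum>k<n. m (R k)) \<le> (\<Sum>k<2 * n. m (R k))"
        by (rule sum_mono2) auto
      also have "\<dots> = (\<Sum>k<n. m (R (2 * k + 0))) + (\<Sum>k<n. m (R (2 * k + 1)))"
        by (induction n) (auto simp: algebra_simps)
      also have "\<dots> \<le> m A + m A" by (intro add_mono half)
      finally show ?thesis .
    qed
    then have "(\<Sum>k. m (R k)) \<le> m A + m A" by (intro suminf_le_const) auto
    then have "(\<Sum>k. m (R k)) \<noteq> \<infinity>" using fin by (auto simp: top_unique)
    then have tail: "(\<lambda>n. \<Sum>k. m (R (k + n))) \<longlonglongrightarrow> 0" by (rule suminf_tail_ennreal)
    \<comment> \<open>Up to a tail of shells, \<open>A - C\<close> is \<open>D n\<close>, which has
      distance at least \<open>1 / Suc n\<close> from \<open>A \<inter> C\<close>. The tail vanishes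
      as \<open>n\<close> grows.\<close>
    have step: "m (A \<inter> C) + m (A - C) \<le> m A + (\<Sum>k. m (R (k + n)))" for n
    proof -
      have "A - C \<subseteq> D n \<union> (\<Union>k. R (k + n))"
      proof
        fix x assume x: "x \<in> A - C"
        then have "0 < infdist x C"
          using infdist_pos_not_in_closed[OF C ne] by auto
        then obtain q where q: "1 / real (Suc q) < infdist x C"
          using nat_approx_posE by blast
        have "x \<in> D q" using q x by (auto simp: D_def)
        define l where "l = (LEAST q. x \<in> D q)"
        have l: "x \<in> D l" "\<And>j. x \<in> D j \<Longrightarrow> l \<le> j"
          unfolding l_def using \<open>x \<in> D q\<close> by (auto intro: LeastI Least_le)
        show "x \<in> D n \<union> (\<Union>k. R (k + n))"
        proof (cases "l \<le> n")
          case True then show ?thesis using l D_mono by auto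
        next
          case False
          then have "x \<in> R ((l - 1 - n) + n)"
            using l(1) l(2)[of "l - 1"] by (auto simp: R_def Suc_diff_le)
          then show ?thesis by blast
        qed
      qed
      then have "m (A - C) \<le> m (D n \<union> (\<Union>k. R (k + n)))" by (rule mono)
      also have "\<dots> \<le> m (D n) + m (\<Union>k. R (k + n))" by (rule sub)
      also have "\<dots> \<le> m (D n) + (\<Sum>k. m (R (k + n)))" by (intro add_left_mono csub)
      finally have "m (A - C) \<le> m (D n) + (\<Sum>k. m (R (k + n)))" .
      then have "m (A \<inter> C) + m (A - C) \<le> (m (A \<inter> C) + m (D n)) + (\<Sum>k. m (R (k + n)))"
        by (simp add: add.assoc add_left_mono)
      also have "m (A \<inter> C) + m (D n) \<le> m ((A \<inter> C) \<union> D n)"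
      proof (rule sep)
        fix a b assume "a \<in> A \<inter> C" "b \<in> D n"
        then show "1 / real (Suc n) \<le> dist a b"
          using infdist_le[of a C b] by (auto simp: D_def dist_commute)
      qed simp
      also have "\<dots> \<le> m A" by (rule mono) (auto simp: D_def)
      finally show ?thesis by (simp add: add_right_mono)
    qed
    have "(\<lambda>n. m A + (\<Sum>k. m (R (k + n)))) \<longlonglongrightarrow> m A + 0"
      by (intro tendsto_add tendsto_const tail)
    then show ?thesis
      using step by (intro LIMSEQ_le_const[where X = "\<lambda>n. m A + (\<Sum>k. m (R (k + n)))"]) auto
  qed
  have "m (C \<inter> A) + m ((UNIV - C) \<inter> A) = m A" for A
  proof (rule antisym)
    have eq: "C \<inter> A = A \<inter> C" "(UNIV - C) \<inter> A = A - C" by auto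
    show "m (C \<inter> A) + m ((UNIV - C) \<inter> A) \<le> m A"
      unfolding eq using key[of A] by (cases "m A = \<infinity> \<or> C = {}") (auto simp: empty)
    have "m A \<le> m ((C \<inter> A) \<union> ((UNIV - C) \<inter> A))" by (rule mono) auto
    then show "m A \<le> m (C \<inter> A) + m ((UNIV - C) \<inter> A)" using sub order_trans by blast
  qed
  then show ?thesis by (simp add: lambda_system_def)
qed

text \<open>Closed sets satisfy Caratheodory's criterion and generate the Borel sets. This is what
  makes the continuous approximating gradients measurable, hence candidates for
  \<open>Lp_space\<close>.\<close>

lemma borel_subset_sets_hausdorff_measure:
  "sets borel \<subseteq> sets (hausdorff_measure N :: 'a::metric_space measure)"
proof -
  have "sigma_sets UNIV (Collect closed) \<subseteq> sets (hausdorff_measure N :: 'a measure)"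
  proof -
    have "Collect closed \<subseteq> sets (hausdorff_measure N :: 'a measure)"
      unfolding sets_hausdorff_measure
      using metric_outer_measure_closed[OF outer_measure_space_hausdorff] hausdorff_outer_measure_separated
      by blast
    then show ?thesis
      using sets.sigma_sets_subset[of _ "hausdorff_measure N :: 'a measure"] by simp
  qed
  then show ?thesis by (simp add: borel_eq_closed)
qed

lemma borel_measurable_hausdorff_measure:
  fixes f :: "'a::metric_space \<Rightarrow> 'b::topological_space"
  assumes "f \<in> borel_measurable borel"
  shows "f \<in> borel_measurable (hausdorff_measure N)"
  using assms borel_subset_sets_hausdorff_measure[of N, where 'a = 'a] unfolding measurable_def by auto

section \<open>Limits of discrete chains\<close>

text \<open>A version of Arzela-Ascoli for possibly discontinuous maps that are 1-Lipschitz up to a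
  vanishing error, as step parametrizations of chains are. Convergence on the rationals spreads to
  all reals because the error disappears in the limit.\<close>

lemma arzela_ascoli_asymptotically_lipschitz:
  fixes \<eta> :: "nat \<Rightarrow> real \<Rightarrow> 'a::metric_space"
  assumes cpt: "compact (UNIV :: 'a set)"
    and lip: "\<And>n s t. dist (\<eta> n s) (\<eta> n t) \<le> \<bar>s - t\<bar> + \<delta> n"
    and \<delta>: "\<delta> \<longlonglongrightarrow> 0"
  obtains r \<gamma> where "strict_mono r" "\<And>t. (\<lambda>n. \<eta> (r n) t) \<longlonglongrightarrow> \<gamma> t"
    "\<And>s t. dist (\<gamma> s) (\<gamma> t) \<le> \<bar>s - t\<bar>"
proof -
  have "compact_space (euclidean :: 'a topology)"
    using cpt by (simp add: compact_space_def)
  then have "compact_space (product_topology (\<lambda>_. euclidean) (UNIV :: rat set) :: (rat \<Rightarrow> 'a) topology)"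
    by (simp add: compact_space_product_topology)
  then have "compact (UNIV :: (rat \<Rightarrow> 'a) set)"
    by (simp add: euclidean_product_topology compact_space_def)
  \<comment> \<open>Tychonoff replaces the diagonal argument: the index type \<open>rat\<close> is
    countable, so the product is first countable and compactness yields convergent
    subsequences.\<close>
  then have "seq_compact (UNIV :: (rat \<Rightarrow> 'a) set)"
    by (rule compact_imp_seq_compact)
  then obtain r and \<Gamma> :: "rat \<Rightarrow> 'a" where r: "strict_mono r"
    and \<Gamma>: "((\<lambda>n q. \<eta> n (of_rat q)) \<circ> r) \<longlonglongrightarrow> \<Gamma>"
    unfolding seq_compact_def by (metis UNIV_I)
  have conv_rat: "(\<lambda>n. \<eta> (r n) (of_rat q)) \<longlonglongrightarrow> \<Gamma> q" for q
  proof -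
    have "continuous_on UNIV (\<lambda>f :: rat \<Rightarrow> 'a. f q)" by simp
    then have "isCont (\<lambda>f :: rat \<Rightarrow> 'a. f q) \<Gamma>"
      using continuous_on_eq_continuous_at[OF open_UNIV] UNIV_I by blast
    from isCont_tendsto_compose[OF this \<Gamma>] show ?thesis by (simp add: comp_def)
  qed
  have \<delta>r: "(\<lambda>n. \<delta> (r n)) \<longlonglongrightarrow> 0"
    using LIMSEQ_subseq_LIMSEQ[OF \<delta> r] by (simp add: comp_def)
  have "\<exists>z. (\<lambda>n. \<eta> (r n) t) \<longlonglongrightarrow> z" for t
  proof -
    have "Cauchy (\<lambda>n. \<eta> (r n) t)"
    proof (rule metric_CauchyI)
      fix e :: real assume e: "0 < e"
      \<comment> \<open>Parameter distance, Lipschitz error and distance to the limit at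
        \<open>q\<close> cost \<open>e / 8\<close> each, so two late terms at \<open>t\<close>
        differ by less than \<open>6 * e / 8\<close>.\<close>
      obtain q where q: "t < of_rat q" "of_rat q < t + e / 8"
        using of_rat_dense[of t "t + e / 8"] e by auto
      have "\<forall>\<^sub>F n in sequentially. dist (\<eta> (r n) (of_rat q)) (\<Gamma> q) < e / 8"
        by (rule tendstoD[OF conv_rat]) (use e in simp)
      moreover have "\<forall>\<^sub>F n in sequentially. \<delta> (r n) < e / 8"
        by (rule order_tendstoD[OF \<delta>r]) (use e in simp)
      ultimately have "\<forall>\<^sub>F n in sequentially. dist (\<eta> (r n) (of_rat q)) (\<Gamma> q) < e / 8 \<and> \<delta> (r n) < e / 8"
        by (rule eventually_conj)
      then obtain M where M: "\<And>n. n \<ge> M \<Longrightarrow> dist (\<eta> (r n) (of_rat q)) (\<Gamma> q) < e / 8"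
        "\<And>n. n \<ge> M \<Longrightarrow> \<delta> (r n) < e / 8"
        unfolding eventually_sequentially by blast
      have near: "dist (\<eta> (r n) t) (\<Gamma> q) < 3 * e / 8" if "n \<ge> M" for n
        using lip[of "r n" t "of_rat q"] M[OF that] q
          dist_triangle[of "\<eta> (r n) t" "\<Gamma> q" "\<eta> (r n) (of_rat q)"] by linarith
      show "\<exists>M. \<forall>m\<ge>M. \<forall>n\<ge>M. dist (\<eta> (r m) t) (\<eta> (r n) t) < e"
      proof (intro exI allI impI)
        fix m n assume "m \<ge> M" "n \<ge> M"
        with near[of m] near[of n] show "dist (\<eta> (r m) t) (\<eta> (r n) t) < e"
          using dist_triangle2[of "\<eta> (r m) t" "\<eta> (r n) t" "\<Gamma> q"] e by linarith
      qed
    qed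
    then show ?thesis
      using compact_imp_complete[OF cpt] unfolding complete_def by (metis UNIV_I)
  qed
  then obtain \<gamma> where \<gamma>: "\<And>t. (\<lambda>n. \<eta> (r n) t) \<longlonglongrightarrow> \<gamma> t" by metis
  have "dist (\<gamma> s) (\<gamma> t) \<le> \<bar>s - t\<bar>" for s t
  proof (rule tendsto_le)
    show "(\<lambda>n. dist (\<eta> (r n) s) (\<eta> (r n) t)) \<longlonglongrightarrow> dist (\<gamma> s) (\<gamma> t)"
      by (intro tendsto_dist \<gamma>)
    show "(\<lambda>n. \<bar>s - t\<bar> + \<delta> (r n)) \<longlonglongrightarrow> \<bar>s - t\<bar>"
      using tendsto_add[OF tendsto_const \<delta>r] by simp
  qed (use lip in auto)
  with r \<gamma> show ?thesis using that by blast
qed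

text \<open>The chain is run through at unit speed on average: \<open>\<eta>\<close> waits at
  \<open>x j\<close> during \<open>[s j, s (Suc j))\<close> and then jumps. Each jump is shorter
  than \<open>\<delta>\<close>, which accounts for the additive error.\<close>

lemma chain_parametrization:
  fixes x :: "nat \<Rightarrow> 'a::metric_space"
  assumes step: "\<And>i. i < k \<Longrightarrow> dist (x i) (x (Suc i)) < \<delta>" and "0 < \<delta>"
  defines "s \<equiv> \<lambda>j. \<Sum>i<j. dist (x i) (x (Suc i))"
  obtains \<eta> :: "real \<Rightarrow> 'a" where
    "\<eta> 0 = x 0" "\<eta> (s k) = x k"
    "\<And>t. 0 \<le> t \<Longrightarrow> t < s k \<Longrightarrow> \<exists>j<k. s j \<le> t \<and> t < s (Suc j) \<and> \<eta> t = x j"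
    "\<And>t t'. dist (\<eta> t) (\<eta> t') \<le> \<bar>t - t'\<bar> + \<delta>"
proof -
  have s_diff: "dist (x i) (x j) \<le> s j - s i" if "i \<le> j" for i j
    using that
  proof (induction j rule: dec_induct)
    case (step j)
    then show ?case using dist_triangle[of "x i" "x (Suc j)" "x j"] by (simp add: s_def)
  qed simp
  have s_mono: "s i \<le> s j" if "i \<le> j" for i j
    using s_diff[OF that] zero_le_dist[of "x i" "x j"] by linarith
  have s0: "s 0 = 0" by (simp add: s_def)
  \<comment> \<open>The alternative \<open>j = k\<close> makes the minimum exist for every
    \<open>t\<close> and freezes the parametrization at the last vertex.\<close>
  define J where "J t = (LEAST j. j = k \<or> t < s (Suc j))" for t
  have J1: "J t = k \<or> t < s (Suc (J t))" for t
    unfolding J_def by (rule LeastI[of _ k]) simp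
  have J2: "J t \<le> j" if "j = k \<or> t < s (Suc j)" for t j
    unfolding J_def using that by (rule Least_le)
  have Jk: "J t \<le> k" for t using J2 by simp
  have sJ: "s (J t) \<le> t" if "0 \<le> t" for t
  proof (cases "J t")
    case 0 then show ?thesis using that s0 by simp
  next
    case (Suc j)
    then show ?thesis using J2[where j = j and t = t] by force
  qed
  have J_mono: "J t \<le> J t'" if "t \<le> t'" for t t'
    using J1[of t'] J2[of "J t'" t] that by auto
  define \<eta> where "\<eta> t = x (J (max 0 t))" for t
  have lip0: "dist (x (J t)) (x (J t')) \<le> t' - t + \<delta>" if "0 \<le> t" "t \<le> t'" for t t'
  proof (cases "J t = J t'")
    case True then show ?thesis using that \<open>0 < \<delta>\<close> by simp
  next
    case False
    then have lt: "J t < J t'" using J_mono that by (simp add: nat_less_le)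
    then have "t < s (Suc (J t))" "J t < k" using J1[of t] Jk[of t'] by auto
    moreover have "s (Suc (J t)) = s (J t) + dist (x (J t)) (x (Suc (J t)))" by (simp add: s_def)
    \<comment> \<open>Only the unfinished step at \<open>t\<close> is lost: the distance is at most
      \<open>s (J t') - s (J t)\<close>, with \<open>s (J t') \<le> t'\<close>.\<close>
    ultimately have "t < s (J t) + \<delta>" using step[of "J t"] by linarith
    then show ?thesis using s_diff[of "J t" "J t'"] sJ[of t'] lt that by linarith
  qed
  show ?thesis
  proof
    \<comment> \<open>\<open>J 0\<close> exceeds 0 when the chain begins with steps of length 0, but
      then it has not left \<open>x 0\<close>.\<close>
    have "dist (x 0) (x (J 0)) \<le> 0" using s_diff[of 0 "J 0"] sJ[of 0] s0 by linarith
    then show "\<eta> 0 = x 0" by (simp add: \<eta>_def)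
    have "0 \<le> s k" using s_mono[of 0 k] s0 by simp
    moreover have "J (s k) = k"
      using J1[of "s k"] Jk[of "s k"] s_mono[of "Suc (J (s k))" k] by fastforce
    ultimately show "\<eta> (s k) = x k" by (simp add: \<eta>_def)
  next
    fix t assume t: "0 \<le> t" "t < s k"
    then have "J t < k" "t < s (Suc (J t))"
      using sJ[of t] J1[of t] Jk[of t] by (metis leD nat_less_le)+
    then show "\<exists>j<k. s j \<le> t \<and> t < s (Suc j) \<and> \<eta> t = x j"
      using t sJ[of t] by (auto simp: \<eta>_def max_absorb2 intro!: exI[of _ "J t"])
  next
    fix t t' :: real
    have *: "dist (\<eta> t) (\<eta> t') \<le> \<bar>t - t'\<bar> + \<delta>" if "t \<le> t'" for t t'
      using lip0[of "max 0 t" "max 0 t'"] that unfolding \<eta>_def by (auto simp: max_def split: if_splits)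
    show "dist (\<eta> t) (\<eta> t') \<le> \<bar>t - t'\<bar> + \<delta>"
      using *[of t t'] *[of t' t] by (cases "t \<le> t'") (auto simp: dist_commute abs_minus_commute)
  qed
qed

text \<open>Expansion bounds the diameter of the preimage by \<open>b - a\<close>, so the interval
  from its infimum to its supremum is short enough. A Borel cover is given because the preimage
  itself may fail to be measurable.\<close>

lemma expanding_preimage_cover:
  fixes \<Psi> :: "real \<Rightarrow> real"
  assumes exp: "\<And>s s'. s \<in> S \<Longrightarrow> s' \<in> S \<Longrightarrow> \<bar>s - s'\<bar> \<le> \<bar>\<Psi> s - \<Psi> s'\<bar>" and "a \<le> b"
  obtains Q where "Q \<in> sets borel" "{s \<in> S. a \<le> \<Psi> s \<and> \<Psi> s < b} \<subseteq> Q" "emeasure lborel Q \<le> ennreal (b - a)"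
proof (cases "{s \<in> S. a \<le> \<Psi> s \<and> \<Psi> s < b} = {}")
  case True
  then show ?thesis by (intro that[of "{}"]) auto
next
  case False
  define P where "P = {s \<in> S. a \<le> \<Psi> s \<and> \<Psi> s < b}"
  have P: "P \<noteq> {}" using False by (simp add: P_def)
  have diff: "s - s' \<le> b - a" if "s \<in> P" "s' \<in> P" for s s'
    using exp[of s s'] that by (auto simp: P_def)
  obtain s0 where "s0 \<in> P" using P by auto
  have bdd: "bdd_above P" "bdd_below P"
    using diff[OF _ \<open>s0 \<in> P\<close>] diff[OF \<open>s0 \<in> P\<close>]
    by (auto intro!: bdd_aboveI[of _ "s0 + (b - a)"] bdd_belowI[of _ "s0 - (b - a)"] simp: algebra_simps)
  have "Sup P \<le> Inf P + (b - a)"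
  proof (rule cSup_least[OF P])
    fix s assume "s \<in> P"
    then have "s - (b - a) \<le> Inf P" by (intro cInf_greatest[OF P]) (use diff in force)
    then show "s \<le> Inf P + (b - a)" by simp
  qed
  moreover have "Inf P \<le> Sup P" using P bdd by (simp add: cInf_le_cSup)
  ultimately have "emeasure lborel {Inf P..Sup P} \<le> ennreal (b - a)"
    by (simp add: ennreal_leI)
  moreover have "P \<subseteq> {Inf P..Sup P}" using bdd by (auto intro: cInf_lower cSup_upper)
  ultimately show ?thesis by (intro that[of "{Inf P..Sup P}"]) (auto simp: P_def)
qed

section \<open>Length and arc-length parametrization of Lipschitz curves\<close>

lemma curve_length_le_lipschitz:
  fixes \<beta> :: "real \<Rightarrow> 'a::metric_space"
  assumes lip: "\<And>s t. s \<in> {a..b} \<Longrightarrow> t \<in> {a..b} \<Longrightarrow> dist (\<beta> s) (\<beta> t) \<le> l * \<bar>s - t\<bar>"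
  shows "curve_length \<beta> a b \<le> ennreal (l * (b - a))"
  unfolding curve_length_def
proof (rule SUP_least, clarify)
  fix n :: nat and t :: "nat \<Rightarrow> real"
  assume t: "mono_on {..n} t" "a = t 0" "b = t n"
  have "(\<Sum>i<n. ennreal (dist (\<beta> (t i)) (\<beta> (t (Suc i))))) = ennreal (\<Sum>i<n. dist (\<beta> (t i)) (\<beta> (t (Suc i))))"
    by (rule sum_ennreal) simp
  also have "(\<Sum>i<n. dist (\<beta> (t i)) (\<beta> (t (Suc i)))) \<le> (\<Sum>i<n. l * (t (Suc i) - t i))"
  proof (rule sum_mono)
    fix i assume "i \<in> {..<n}"
    then have "t 0 \<le> t i" "t i \<le> t (Suc i)" "t (Suc i) \<le> t n"
      using t(1) by (auto intro!: mono_onD[OF t(1)])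
    then show "dist (\<beta> (t i)) (\<beta> (t (Suc i))) \<le> l * (t (Suc i) - t i)"
      using lip[of "t i" "t (Suc i)"] t by auto
  qed
  also have "(\<Sum>i<n. l * (t (Suc i) - t i)) = l * (b - a)"
    using sum_lessThan_telescope[of t n] t by (simp add: sum_distrib_left[symmetric])
  finally show "(\<Sum>i<n. ennreal (dist (\<beta> (t i)) (\<beta> (t (Suc i))))) \<le> ennreal (l * (t n - t 0))"
    using t by (simp add: ennreal_leI)
qed

lemma curve_length_mono:
  fixes \<beta> :: "real \<Rightarrow> 'a::metric_space"
  assumes "a \<le> b" "b \<le> c"
  shows "curve_length \<beta> a b \<le> curve_length \<beta> a c"
  unfolding curve_length_def
proof (rule SUP_least, clarify)
  fix n :: nat and t :: "nat \<Rightarrow> real"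
  assume t: "mono_on {..n} t" "a = t 0" "b = t n"
  let ?t = "t(Suc n := c)"
  have tn: "t i \<le> c" if "i \<le> n" for i
    using mono_onD[OF t(1), of i n] that t(3) assms by auto
  have "mono_on {..Suc n} ?t"
    using tn by (auto intro!: mono_onI mono_onD[OF t(1)] simp: le_Suc_eq)
  then have "(Suc n, ?t) \<in> {(n, t). mono_on {..n} t \<and> t 0 = t 0 \<and> t 0 = a \<and> t n = c}"
    using t by simp
  then have "(\<Sum>i<Suc n. ennreal (dist (\<beta> (?t i)) (\<beta> (?t (Suc i)))))
    \<le> (SUP (n, t) \<in> {(n :: nat, t :: nat \<Rightarrow> real). mono_on {..n} t \<and> t 0 = a \<and> t n = c}.
        \<Sum>i<n. ennreal (dist (\<beta> (t i)) (\<beta> (t (Suc i)))))"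
    by (intro SUP_upper2[of "(Suc n, ?t)"]) (auto simp: sum_nonneg)
  moreover have "(\<Sum>i<n. ennreal (dist (\<beta> (t i)) (\<beta> (t (Suc i)))))
    \<le> (\<Sum>i<Suc n. ennreal (dist (\<beta> (?t i)) (\<beta> (?t (Suc i)))))"
    by simp
  ultimately show "(\<Sum>i<n. ennreal (dist (\<beta> (t i)) (\<beta> (t (Suc i)))))
    \<le> (SUP (n, t') \<in> {(n :: nat, t' :: nat \<Rightarrow> real). mono_on {..n} t' \<and> t' 0 = t 0 \<and> t' n = c}.
        \<Sum>i<n. ennreal (dist (\<beta> (t' i)) (\<beta> (t' (Suc i)))))"
    unfolding t(2)[symmetric] by (rule order_trans[rotated])
qed

text \<open>A partition of \<open>[a, c]\<close> is cut at \<open>b\<close> by passing to \<open>min (t i) b\<close> and \<open>max (t i) b\<close>.\<close>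

lemma curve_length_subadd:
  fixes \<beta> :: "real \<Rightarrow> 'a::metric_space"
  assumes "a \<le> b" "b \<le> c"
  shows "curve_length \<beta> a c \<le> curve_length \<beta> a b + curve_length \<beta> b c"
  unfolding curve_length_def[of \<beta> a c]
proof (rule SUP_least, clarify)
  fix n :: nat and t :: "nat \<Rightarrow> real"
  assume t: "mono_on {..n} t" "a = t 0" "c = t n"
  let ?d = "\<lambda>t i. ennreal (dist (\<beta> (t i)) (\<beta> (t (Suc i))))"
  have "(\<Sum>i<n. ?d t i) \<le> (\<Sum>i<n. ?d (\<lambda>i. min (t i) b) i + ?d (\<lambda>i. max (t i) b) i)"
  proof (rule sum_mono)
    fix i assume "i \<in> {..<n}"
    then have "t i \<le> t (Suc i)" by (auto intro!: mono_onD[OF t(1)])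
    then have "dist (\<beta> (t i)) (\<beta> (t (Suc i)))
      \<le> dist (\<beta> (min (t i) b)) (\<beta> (min (t (Suc i)) b)) + dist (\<beta> (max (t i) b)) (\<beta> (max (t (Suc i)) b))"
      using dist_triangle[of "\<beta> (t i)" "\<beta> (t (Suc i))" "\<beta> b"]
      by (cases "t (Suc i) \<le> b"; cases "b \<le> t i") (auto simp: min_def max_def)
    then show "?d t i \<le> ?d (\<lambda>i. min (t i) b) i + ?d (\<lambda>i. max (t i) b) i"
      by (simp flip: ennreal_plus add: ennreal_leI)
  qed
  also have "\<dots> = (\<Sum>i<n. ?d (\<lambda>i. min (t i) b) i) + (\<Sum>i<n. ?d (\<lambda>i. max (t i) b) i)"
    by (rule sum.distrib)
  also have "\<dots> \<le> curve_length \<beta> (t 0) b + curve_length \<beta> b (t n)"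
  proof (rule add_mono)
    have "mono_on {..n} (\<lambda>i. min (t i) b)" "mono_on {..n} (\<lambda>i. max (t i) b)"
      by (intro mono_onI min.mono max.mono mono_onD[OF t(1)] order_refl; assumption)+
    note mono = this
    show "(\<Sum>i<n. ?d (\<lambda>i. min (t i) b) i) \<le> curve_length \<beta> (t 0) b"
      unfolding curve_length_def using assms t mono
      by (intro SUP_upper2[of "(n, \<lambda>i. min (t i) b)"]) auto
    show "(\<Sum>i<n. ?d (\<lambda>i. max (t i) b) i) \<le> curve_length \<beta> b (t n)"
      unfolding curve_length_def using assms t mono
      by (intro SUP_upper2[of "(n, \<lambda>i. max (t i) b)"]) auto
  qed
  finally show "(\<Sum>i<n. ?d t i) \<le> curve_length \<beta> (t 0) b + curve_length \<beta> b (t n)" .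
qed

text \<open>\<open>\<psi>\<close> is a right inverse of the length function \<open>V\<close>. As
  \<open>V\<close> is \<open>l\<close>-Lipschitz, \<open>\<psi>\<close> expands distances by at
  least \<open>1 / l\<close> when \<open>l > 0\<close>, which is all that is needed to compare arc
  length with the given parameter.\<close>

lemma lipschitz_arclength_param:
  fixes \<beta> :: "real \<Rightarrow> 'a::metric_space"
  assumes lip: "\<And>s t. s \<in> {0..1} \<Longrightarrow> t \<in> {0..1} \<Longrightarrow> dist (\<beta> s) (\<beta> t) \<le> l * \<bar>s - t\<bar>" and "0 \<le> l"
  defines "L \<equiv> enn2real (curve_length \<beta> 0 1)"
  shows "rectifiable \<beta>"
    and "\<exists>\<psi>. \<forall>s\<in>{0..L}. \<psi> s \<in> {0..1} \<and> arclength_param \<beta> s = \<beta> (\<psi> s) \<and>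
           L - s \<le> l * (1 - \<psi> s) \<and> (\<forall>s'\<in>{0..L}. \<bar>s - s'\<bar> \<le> l * \<bar>\<psi> s - \<psi> s'\<bar>)"
proof -
  have len: "curve_length \<beta> s t \<le> ennreal (l * (t - s))" if "0 \<le> s" "t \<le> 1" for s t
    by (rule curve_length_le_lipschitz) (use lip that in auto)
  have fin: "curve_length \<beta> 0 t < \<infinity>" if "t \<le> 1" for t
    using len[of 0 t] that by (auto simp: le_less_trans)
  have "l-lipschitz_on {0..1} \<beta>"
    using lip \<open>0 \<le> l\<close> by (auto simp: lipschitz_on_def dist_real_def)
  then have "path \<beta>"
    unfolding path_def by (rule lipschitz_on_continuous_on)
  then show "rectifiable \<beta>" using fin by (simp add: rectifiable_def)
  define V where "V t = enn2real (curve_length \<beta> 0 t)" for t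
  have V_le: "V s \<le> V t" "V t \<le> V s + l * (t - s)" if "0 \<le> s" "s \<le> t" "t \<le> 1" for s t
  proof -
    show "V s \<le> V t"
      unfolding V_def by (rule enn2real_mono[OF curve_length_mono]) (use that fin in auto)
    have "curve_length \<beta> 0 t \<le> curve_length \<beta> 0 s + ennreal (l * (t - s))"
      by (rule order_trans[OF curve_length_subadd[of 0 s t]]) (use that len in \<open>auto intro: add_left_mono\<close>)
    also have "\<dots> = ennreal (V s + l * (t - s))"
      unfolding V_def using that fin[of s] \<open>0 \<le> l\<close> by (simp add: ennreal_plus)
    finally show "V t \<le> V s + l * (t - s)"
      unfolding V_def[of t] using that \<open>0 \<le> l\<close> by (intro enn2real_leI) (auto simp: V_def)
  qed
  have V_lip: "\<bar>V s - V t\<bar> \<le> l * \<bar>s - t\<bar>" if "s \<in> {0..1}" "t \<in> {0..1}" for s t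
    using V_le[of s t] V_le[of t s] that by (cases "s \<le> t") auto
  have "V 0 = 0"
    using len[of 0 0] by (simp add: V_def)
  have "V 1 = L" by (simp add: V_def L_def)
  have "l-lipschitz_on {0..1} V"
    using V_lip \<open>0 \<le> l\<close> by (auto simp: lipschitz_on_def dist_real_def)
  then have "continuous_on {0..1} V" by (rule lipschitz_on_continuous_on)
  then have surj: "\<exists>t\<in>{0..1}. V t = s" if "s \<in> {0..L}" for s
    using IVT'[of V 0 s 1] that \<open>V 0 = 0\<close> \<open>V 1 = L\<close> by auto
  \<comment> \<open>The same choice of inverse as in \<open>arclength_param\<close>, so that
    \<open>arclength_param \<beta>\<close> is \<open>\<beta>\<close> after \<open>\<psi>\<close> by
    definition.\<close>
  define \<psi> where "\<psi> = inv_into {0..1} V"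
  have \<psi>: "\<psi> s \<in> {0..1}" "V (\<psi> s) = s" if "s \<in> {0..L}" for s
  proof -
    have "s \<in> V ` {0..1}" using surj[OF that] by auto
    then show "\<psi> s \<in> {0..1}" "V (\<psi> s) = s"
      unfolding \<psi>_def by (rule inv_into_into, rule f_inv_into_f)
  qed
  show "\<exists>\<psi>. \<forall>s\<in>{0..L}. \<psi> s \<in> {0..1} \<and> arclength_param \<beta> s = \<beta> (\<psi> s) \<and>
           L - s \<le> l * (1 - \<psi> s) \<and> (\<forall>s'\<in>{0..L}. \<bar>s - s'\<bar> \<le> l * \<bar>\<psi> s - \<psi> s'\<bar>)"
  proof (intro exI ballI conjI)
    fix s assume s: "s \<in> {0..L}"
    show "\<psi> s \<in> {0..1}" by (rule \<psi>[OF s])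
    show "arclength_param \<beta> s = \<beta> (\<psi> s)"
      by (simp add: arclength_param_def \<psi>_def V_def[abs_def])
    show "L - s \<le> l * (1 - \<psi> s)"
      using V_le[of "\<psi> s" 1] \<psi>[OF s] \<open>V 1 = L\<close> by auto
    fix s' assume s': "s' \<in> {0..L}"
    show "\<bar>s - s'\<bar> \<le> l * \<bar>\<psi> s - \<psi> s'\<bar>"
      using V_lip[of "\<psi> s" "\<psi> s'"] \<psi>[OF s] \<psi>[OF s'] by simp
  qed
qed

text \<open>The chain costs dominate integrals of step functions \<open>f n\<close>, and Fatou's
  lemma passes to the limit curve. The last assumption is lower semicontinuity along the sequence:
  it bounds \<open>h n\<close> from below at vertices that move with \<open>n\<close> towards
  \<open>z\<close>.\<close>

lemma chain_limit_curve:
  fixes x :: "nat \<Rightarrow> nat \<Rightarrow> 'a::metric_space" and g :: "'a \<Rightarrow> ereal"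
  assumes cpt: "compact (UNIV :: 'a set)" and "closed E" "closed F"
    and step: "\<And>n i. i < k n \<Longrightarrow> dist (x n i) (x n (Suc i)) < \<delta> n" and \<delta>_pos: "\<And>n. 0 < \<delta> n" and \<delta>: "\<delta> \<longlonglongrightarrow> 0"
    and start: "\<And>n. x n 0 \<in> E" and final: "\<And>n. x n (k n) \<in> F"
    and len: "\<And>n. (\<Sum>i<k n. dist (x n i) (x n (Suc i))) \<le> A"
    and h: "\<And>n y. 0 \<le> h n y"
    and cost: "\<And>n. (\<Sum>i<k n. h n (x n i) * dist (x n i) (x n (Suc i))) \<le> c"
    and liminf: "\<And>z a. ereal a < g z \<Longrightarrow> \<exists>d>0. \<exists>n0. \<forall>n\<ge>n0. \<forall>y\<in>ball z d. a < h n y"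
  shows "\<exists>\<gamma>. rectifiable \<gamma> \<and> \<gamma> 0 \<in> E \<and> \<gamma> 1 \<in> F \<and> curve_integral g \<gamma> \<le> ennreal c"
proof -
  define s where "s n j = (\<Sum>i<j. dist (x n i) (x n (Suc i)))" for n j
  have s_Suc: "s n (Suc j) = s n j + dist (x n j) (x n (Suc j))" for n j by (simp add: s_def)
  have "\<exists>\<eta>. \<eta> 0 = x n 0 \<and> \<eta> (s n (k n)) = x n (k n) \<and>
      (\<forall>t. 0 \<le> t \<longrightarrow> t < s n (k n) \<longrightarrow> (\<exists>j<k n. s n j \<le> t \<and> t < s n (Suc j) \<and> \<eta> t = x n j)) \<and>
      (\<forall>t t'. dist (\<eta> t) (\<eta> t') \<le> \<bar>t - t'\<bar> + \<delta> n)" for n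
    unfolding s_def by (rule chain_parametrization[of "k n" "x n" "\<delta> n"], use step \<delta>_pos in blast, use \<delta>_pos in blast, blast)
  then obtain \<eta> where \<eta>0: "\<And>n. \<eta> n 0 = x n 0" and \<eta>1: "\<And>n. \<eta> n (s n (k n)) = x n (k n)"
    and \<eta>_step: "\<And>n t. 0 \<le> t \<Longrightarrow> t < s n (k n) \<Longrightarrow> \<exists>j<k n. s n j \<le> t \<and> t < s n (Suc j) \<and> \<eta> n t = x n j"
    and \<eta>_lip: "\<And>n t t'. dist (\<eta> n t) (\<eta> n t') \<le> \<bar>t - t'\<bar> + \<delta> n"
    by metis
  have "s n (k n) \<in> {0..A}" for n
    using len by (auto simp: s_def sum_nonneg)
  \<comment> \<open>\<open>l\<close> is the limit of the chain lengths. It bounds the length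
    \<open>L\<close> of the limit curve but may exceed it.\<close>
  then obtain l r1 where l: "l \<in> {0..A}" and r1: "strict_mono r1" and lim_l: "((\<lambda>n. s n (k n)) \<circ> r1) \<longlonglongrightarrow> l"
    using compact_imp_seq_compact[OF compact_Icc, of 0 A] unfolding seq_compact_def by metis
  have \<delta>1: "(\<lambda>n. \<delta> (r1 n)) \<longlonglongrightarrow> 0"
    using LIMSEQ_subseq_LIMSEQ[OF \<delta> r1] by (simp add: comp_def)
  obtain r2 \<gamma> where r2: "strict_mono r2" and \<gamma>': "\<And>t. (\<lambda>n. \<eta> (r1 (r2 n)) t) \<longlonglongrightarrow> \<gamma> t"
    and \<gamma>_lip: "\<And>s t. dist (\<gamma> s) (\<gamma> t) \<le> \<bar>s - t\<bar>"
    using arzela_ascoli_asymptotically_lipschitz[OF cpt \<eta>_lip \<delta>1] by blast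
  define r where "r n = r1 (r2 n)" for n
  have r: "strict_mono r" using r1 r2 by (auto simp: r_def strict_mono_def)
  have \<gamma>: "(\<lambda>n. \<eta> (r n) t) \<longlonglongrightarrow> \<gamma> t" for t using \<gamma>' by (simp add: r_def)
  have \<delta>r: "(\<lambda>n. \<delta> (r n)) \<longlonglongrightarrow> 0"
    using LIMSEQ_subseq_LIMSEQ[OF \<delta> r] by (simp add: comp_def)
  have lim_l: "(\<lambda>n. s (r n) (k (r n))) \<longlonglongrightarrow> l"
    using LIMSEQ_subseq_LIMSEQ[OF lim_l r2] by (simp add: comp_def r_def)
  define \<beta> where "\<beta> t = \<gamma> (l * t)" for t
  have \<beta>0: "\<beta> 0 \<in> E"
    using closed_sequentially[OF \<open>closed E\<close> _ \<gamma>[of 0]] \<eta>0 start by (simp add: \<beta>_def)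
  have \<beta>1: "\<beta> 1 \<in> F"
  proof -
    \<comment> \<open>The final vertex is reached at a parameter varying with \<open>n\<close>, so
      pointwise convergence at \<open>l\<close> is combined with the Lipschitz bound.\<close>
    have "(\<lambda>n. \<bar>s (r n) (k (r n)) - l\<bar> + \<delta> (r n) + dist (\<eta> (r n) l) (\<gamma> l)) \<longlonglongrightarrow> \<bar>l - l\<bar> + 0 + dist (\<gamma> l) (\<gamma> l)"
      by (intro tendsto_intros lim_l \<delta>r \<gamma>)
    then have lim0: "(\<lambda>n. \<bar>s (r n) (k (r n)) - l\<bar> + \<delta> (r n) + dist (\<eta> (r n) l) (\<gamma> l)) \<longlonglongrightarrow> 0"
      by simp
    have le: "dist (\<eta> (r n) (s (r n) (k (r n)))) (\<gamma> l)
        \<le> \<bar>s (r n) (k (r n)) - l\<bar> + \<delta> (r n) + dist (\<eta> (r n) l) (\<gamma> l)" for n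
      using dist_triangle[of "\<eta> (r n) (s (r n) (k (r n)))" "\<gamma> l" "\<eta> (r n) l"]
        \<eta>_lip[of "r n" "s (r n) (k (r n))" l] by linarith
    have "(\<lambda>n. \<eta> (r n) (s (r n) (k (r n)))) \<longlonglongrightarrow> \<gamma> l"
      unfolding tendsto_dist_iff[of _ "\<gamma> l"]
      by (rule Lim_null_comparison[OF _ lim0]) (use le in auto)
    then show ?thesis
      using closed_sequentially[OF \<open>closed F\<close>, of "\<lambda>n. x (r n) (k (r n))" "\<gamma> l"] \<eta>1 final by (simp add: \<beta>_def)
  qed
  have \<beta>_lip: "dist (\<beta> s) (\<beta> t) \<le> l * \<bar>s - t\<bar>" for s t
    using \<gamma>_lip[of "l * s" "l * t"] l by (simp add: \<beta>_def abs_mult flip: right_diff_distrib)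
  define L where "L = enn2real (curve_length \<beta> 0 1)"
  have rect: "rectifiable \<beta>"
    by (rule lipschitz_arclength_param(1)[of \<beta> l]) (use \<beta>_lip l in auto)
  have "\<exists>\<psi>. \<forall>s\<in>{0..L}. \<psi> s \<in> {0..1} \<and> arclength_param \<beta> s = \<beta> (\<psi> s) \<and>
      L - s \<le> l * (1 - \<psi> s) \<and> (\<forall>s'\<in>{0..L}. \<bar>s - s'\<bar> \<le> l * \<bar>\<psi> s - \<psi> s'\<bar>)"
    unfolding L_def by (rule lipschitz_arclength_param(2)) (use \<beta>_lip l in auto)
  then obtain \<psi> where \<psi>: "\<And>y. y \<in> {0..L} \<Longrightarrow> \<psi> y \<in> {0..1}"
    "\<And>y. y \<in> {0..L} \<Longrightarrow> arclength_param \<beta> y = \<beta> (\<psi> y)"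
    "\<And>y. y \<in> {0..L} \<Longrightarrow> L - y \<le> l * (1 - \<psi> y)"
    "\<And>y y'. y \<in> {0..L} \<Longrightarrow> y' \<in> {0..L} \<Longrightarrow> \<bar>y - y'\<bar> \<le> l * \<bar>\<psi> y - \<psi> y'\<bar>"
    by blast
  txt \<open>The limit function is only compared with step functions supported on intervals covering the
    \<open>\<psi>\<close>-preimages of the chain steps; this avoids a change of variables along the arc length.\<close>
  define covers where "covers n j Q \<longleftrightarrow> Q \<in> sets borel \<and>
      {y \<in> {0..L}. s n j \<le> l * \<psi> y \<and> l * \<psi> y < s n (Suc j)} \<subseteq> Q \<and>
      emeasure lborel Q \<le> ennreal (dist (x n j) (x n (Suc j)))" for n j Q
  have "\<exists>Q. covers n j Q" for n j
  proof (rule expanding_preimage_cover[of "{0..L}" "\<lambda>y. l * \<psi> y" "s n j" "s n (Suc j)"])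
    fix y y' assume "y \<in> {0..L}" "y' \<in> {0..L}"
    then show "\<bar>y - y'\<bar> \<le> \<bar>l * \<psi> y - l * \<psi> y'\<bar>"
      using \<psi>(4)[of y y'] l by (simp add: abs_mult flip: right_diff_distrib)
  qed (simp add: s_Suc, simp add: s_Suc covers_def, blast)
  then obtain Q where "\<And>n j. covers n j (Q n j)" by metis
  then have Q: "\<And>n j. Q n j \<in> sets borel"
    "\<And>n j. {y \<in> {0..L}. s n j \<le> l * \<psi> y \<and> l * \<psi> y < s n (Suc j)} \<subseteq> Q n j"
    "\<And>n j. emeasure lborel (Q n j) \<le> ennreal (dist (x n j) (x n (Suc j)))"
    unfolding covers_def by blast+
  define f where "f n y = (\<Sum>j<k n. ennreal (h n (x n j)) * indicator (Q n j) y)" for n and y :: real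
  have f_meas: "f n \<in> borel_measurable lborel" for n
    unfolding f_def[abs_def] using Q(1)
    by (intro borel_measurable_sum borel_measurable_times_ennreal borel_measurable_const borel_measurable_indicator) simp
  have int_f: "(\<integral>\<^sup>+y. f n y \<partial>lborel) \<le> ennreal c" for n
  proof -
    have "(\<integral>\<^sup>+y. f n y \<partial>lborel) = (\<Sum>j<k n. ennreal (h n (x n j)) * emeasure lborel (Q n j))"
      unfolding f_def using Q(1)
      by (subst nn_integral_sum)
        (intro borel_measurable_times_ennreal borel_measurable_const borel_measurable_indicator sum.cong
          nn_integral_cmult_indicator refl; simp)+
    also have "\<dots> \<le> (\<Sum>j<k n. ennreal (h n (x n j)) * ennreal (dist (x n j) (x n (Suc j))))"
      by (intro sum_mono mult_left_mono Q(3)) auto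
    also have "\<dots> = ennreal (\<Sum>j<k n. h n (x n j) * dist (x n j) (x n (Suc j)))"
      using h by (simp add: ennreal_mult' [symmetric] ennreal_mult[symmetric])
    also have "\<dots> \<le> ennreal c" by (intro ennreal_leI cost)
    finally show ?thesis .
  qed
  \<comment> \<open>For \<open>y < L\<close> the parameter \<open>l * \<psi> y\<close> lies strictly
    below \<open>l\<close>, hence eventually inside some step of the chain. At \<open>y = L\<close>
    no step need contain it, but one point is negligible.\<close>
  have le_liminf: "e2ennreal (g (arclength_param \<beta> y)) * indicator {0..L} y \<le> liminf (\<lambda>n. f (r n) y)"
    if "y \<noteq> L" for y
  proof (cases "y \<in> {0..L}")
    case True
    let ?t = "l * \<psi> y"
    have t: "0 \<le> ?t" "?t < l"
      using \<psi>(1)[OF True] \<psi>(3)[OF True] that True l by (auto simp: algebra_simps)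
    have "e2ennreal (g (\<gamma> ?t)) \<le> liminf (\<lambda>n. f (r n) y)"
      unfolding le_Liminf_iff
    proof (intro allI impI)
      fix b :: ennreal assume b: "b < e2ennreal (g (\<gamma> ?t))"
      then obtain a where a: "0 \<le> a" "b = ennreal a"
        by (cases b) auto
      have "ereal a < g (\<gamma> ?t)"
        using b e2ennreal_mono[of "g (\<gamma> ?t)" "ereal a"] a by (force simp: not_less[symmetric] e2ennreal_ereal)
      then obtain d n0 where d: "0 < d" "\<And>n y. n \<ge> n0 \<Longrightarrow> y \<in> ball (\<gamma> ?t) d \<Longrightarrow> a < h n y"
        using liminf by blast
      have "\<forall>\<^sub>F n in sequentially. dist (\<eta> (r n) ?t) (\<gamma> ?t) < d"
        by (rule tendstoD[OF \<gamma> d(1)])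
      moreover have "\<forall>\<^sub>F n in sequentially. n0 \<le> r n"
        using eventually_ge_at_top[of n0] by eventually_elim (use seq_suble[OF r] order_trans in blast)
      moreover have "\<forall>\<^sub>F n in sequentially. ?t < s (r n) (k (r n))"
        by (rule order_tendstoD(1)[OF lim_l t(2)])
      ultimately show "\<forall>\<^sub>F n in sequentially. b < f (r n) y"
      proof eventually_elim
        case (elim n)
        obtain j where j: "j < k (r n)" "s (r n) j \<le> ?t" "?t < s (r n) (Suc j)" "\<eta> (r n) ?t = x (r n) j"
          using \<eta>_step[OF t(1) elim(3)] by auto
        have "a < h (r n) (x (r n) j)"
          using d(2)[OF elim(2), of "\<eta> (r n) ?t"] elim(1) j(4) by (simp add: dist_commute)
        then have "b < ennreal (h (r n) (x (r n) j)) * indicator (Q (r n) j) y"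
          using Q(2)[of "r n" j] j True a by (auto simp: indicator_def ennreal_less_iff)
        also have "\<dots> \<le> f (r n) y"
          unfolding f_def by (rule member_le_sum) (use j in auto)
        finally show ?case .
      qed
    qed
    then show ?thesis using True \<psi>(2)[OF True] by (simp add: \<beta>_def)
  qed simp
  have "curve_integral g \<beta> \<le> (\<integral>\<^sup>+y. liminf (\<lambda>n. f (r n) y) \<partial>lborel)"
    unfolding curve_integral_def L_def[symmetric]
    by (intro nn_integral_mono_AE eventually_mono[OF AE_lborel_singleton[of L]] le_liminf)
  also have "\<dots> \<le> liminf (\<lambda>n. \<integral>\<^sup>+y. f (r n) y \<partial>lborel)"
    by (rule nn_integral_liminf) (rule f_meas)
  also have "\<dots> \<le> ennreal c"
    using int_f by (intro Liminf_le) auto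
  finally show ?thesis using rect \<beta>0 \<beta>1 by blast
qed

section \<open>Potentials of discrete chains\<close>

lemma LIP_le:
  assumes "\<And>y z. y \<in> A \<Longrightarrow> z \<in> A \<Longrightarrow> ennreal \<bar>f y - f z\<bar> \<le> K * ennreal (dist y z)"
  shows "LIP f A \<le> K"
  unfolding LIP_def
proof (rule SUP_least, clarify)
  fix y z assume "y \<in> A" "z \<in> A" "y \<noteq> z"
  then show "ennreal (\<bar>f y - f z\<bar> / dist y z) \<le> K"
    using assms[of y z] by (simp add: divide_ennreal[symmetric] divide_le_posI_ennreal mult.commute)
qed

text \<open>Here \<open>v z\<close> is the cheapest cost of a \<open>\<delta>\<close>-chain from \<open>E\<close> to \<open>z\<close>, truncated at 1; prolonging a
  chain by one step controls the increments of \<open>v\<close> at scales below \<open>\<delta>\<close>.\<close>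

lemma discrete_potential:
  fixes h :: "'a::metric_space \<Rightarrow> real"
  assumes h: "\<And>y. 0 \<le> h y" "\<And>y. h y \<le> K" and "0 < \<delta>"
    and cost: "\<And>x k. x 0 \<in> E \<Longrightarrow> x k \<in> F \<Longrightarrow> (\<And>i. i < k \<Longrightarrow> dist (x i) (x (Suc i)) < \<delta>) \<Longrightarrow>
      1 \<le> (\<Sum>i<k. h (x i) * dist (x i) (x (Suc i)))"
  shows "\<exists>v. (\<exists>L. L-lipschitz_on UNIV v) \<and> (\<forall>x. 0 \<le> v x \<and> v x \<le> 1) \<and>
    (\<forall>x\<in>E. v x = 0) \<and> (\<forall>x\<in>F. v x = 1) \<and> local_Lipschitz_upper_gradient h v"
proof -
  \<comment> \<open>Inserting 1 truncates the infimum and keeps the set nonempty where no chain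
    reaches \<open>z\<close>.\<close>
  define S where "S z = insert 1 {\<Sum>i<k. h (x i) * dist (x i) (x (Suc i)) | x k.
    x 0 \<in> E \<and> x k = z \<and> (\<forall>i<k. dist (x i) (x (Suc i)) < \<delta>)}" for z
  define v where "v z = Inf (S z)" for z
  have S_nonneg: "0 \<le> w" if "w \<in> S z" for w z
    using that h by (auto simp: S_def intro!: sum_nonneg)
  have bdd: "bdd_below (S z)" for z
    using S_nonneg by (intro bdd_belowI[of _ 0])
  have v_le: "v z \<le> w" if "w \<in> S z" for z w
    unfolding v_def using that bdd by (rule cInf_lower)
  have v_ge: "b \<le> v z" if "\<And>w. w \<in> S z \<Longrightarrow> b \<le> w" for z b
    unfolding v_def by (rule cInf_greatest) (use that in \<open>auto simp: S_def\<close>)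
  have one: "1 \<in> S z" for z by (simp add: S_def)
  have v01: "0 \<le> v z" "v z \<le> 1" for z
    using v_ge[of z 0] S_nonneg v_le[OF one] by auto
  have vE: "v z = 0" if "z \<in> E" for z
  proof -
    \<comment> \<open>The chain with \<open>k = 0\<close> has an empty cost sum.\<close>
    have "0 \<in> S z"
      unfolding S_def using that by (auto intro!: exI[of _ "\<lambda>_. z"] exI[of _ 0])
    then show ?thesis using v_le[of 0 z] v01(1)[of z] by simp
  qed
  have vF: "v z = 1" if "z \<in> F" for z
  proof -
    have "1 \<le> v z"
      by (rule v_ge) (use that cost in \<open>auto simp: S_def\<close>)
    then show ?thesis using v01(2)[of z] by simp
  qed
  have step: "v z \<le> v y + h y * dist y z" if yz: "dist y z < \<delta>" for y z
  proof -
    have "v z - h y * dist y z \<le> v y"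
    proof (rule v_ge)
      fix w assume "w \<in> S y"
      then consider "w = 1" | x k where "w = (\<Sum>i<k. h (x i) * dist (x i) (x (Suc i)))"
        "x 0 \<in> E" "x k = y" "\<forall>i<k. dist (x i) (x (Suc i)) < \<delta>"
        by (auto simp: S_def)
      then show "v z - h y * dist y z \<le> w"
      proof cases
        case 1
        have "0 \<le> h y * dist y z" using h by simp
        then show ?thesis using 1 v01(2)[of z] by linarith
      next
        case 2
        let ?x = "x(Suc k := z)"
        have "(\<Sum>i<Suc k. h (?x i) * dist (?x i) (?x (Suc i))) \<in> S z"
          unfolding S_def using 2 yz
          by (intro insertI2 CollectI exI[of _ ?x] exI[of _ "Suc k"]) (auto simp: less_Suc_eq)
        then have "v z \<le> (\<Sum>i<Suc k. h (?x i) * dist (?x i) (?x (Suc i)))" by (rule v_le)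
        also have "\<dots> = w + h y * dist y z" using 2 by simp
        finally show ?thesis by simp
      qed
    qed
    then show ?thesis by simp
  qed
  have "0 \<le> K" using h order_trans by blast
  \<comment> \<open>Near points are joined by one step of slope at most \<open>K\<close>; for far
    points the oscillation bound 1 is at most \<open>dist y z / \<delta>\<close>.\<close>
  have lip: "\<bar>v y - v z\<bar> \<le> max K (1 / \<delta>) * dist y z" for y z
  proof (cases "dist y z < \<delta>")
    case True
    have "h y * dist y z \<le> max K (1 / \<delta>) * dist y z" "h z * dist y z \<le> max K (1 / \<delta>) * dist y z"
      using h(2) by (auto intro!: mult_right_mono simp: le_max_iff_disj)
    then show ?thesis using step[of y z] step[of z y] True by (simp add: dist_commute abs_le_iff)
  next
    case False
    have "\<bar>v y - v z\<bar> \<le> 1" using v01[of y] v01[of z] by linarith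
    also have "\<dots> \<le> 1 / \<delta> * dist y z" using False \<open>0 < \<delta>\<close> by (simp add: field_simps)
    also have "\<dots> \<le> max K (1 / \<delta>) * dist y z" by (intro mult_right_mono) auto
    finally show ?thesis .
  qed
  \<comment> \<open>Any two points of a ball of radius below \<open>\<delta> / 2\<close> are one
    step apart in both directions, at slopes \<open>h y\<close> and \<open>h z\<close>.\<close>
  have "LIP v (ball x r) \<le> (SUP y \<in> ball x (2 * r). ennreal (h y))" if r: "0 < r" "r < \<delta> / 2" for x r
  proof (rule LIP_le)
    fix y z assume y: "y \<in> ball x r" and z: "z \<in> ball x r"
    let ?K = "SUP y \<in> ball x (2 * r). ennreal (h y)"
    have d: "dist y z < \<delta>" using dist_triangle2[of y z x] y z r by (simp add: dist_commute)
    have "ennreal (h y) \<le> ?K" "ennreal (h z) \<le> ?K" using y z r by (auto intro!: SUP_upper)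
    then have K: "ennreal (max (h y) (h z)) \<le> ?K" by (auto simp: max_def)
    have "h y * dist y z \<le> max (h y) (h z) * dist y z" "h z * dist y z \<le> max (h y) (h z) * dist y z"
      by (auto intro!: mult_right_mono)
    then have "\<bar>v y - v z\<bar> \<le> max (h y) (h z) * dist y z"
      using step[of y z] step[of z y] d by (simp add: dist_commute abs_le_iff)
    then have "ennreal \<bar>v y - v z\<bar> \<le> ennreal (max (h y) (h z)) * ennreal (dist y z)"
      using h by (simp flip: ennreal_mult' add: ennreal_leI le_max_iff_disj)
    also have "\<dots> \<le> ?K * ennreal (dist y z)" by (intro mult_right_mono K) simp
    finally show "ennreal \<bar>v y - v z\<bar> \<le> ?K * ennreal (dist y z)" .
  qed
  then have "local_Lipschitz_upper_gradient h v"
    unfolding local_Lipschitz_upper_gradient_def using h \<open>0 < \<delta>\<close>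
    by (auto intro!: exI[of _ "\<delta> / 2"])
  moreover have "(max K (1 / \<delta>))-lipschitz_on UNIV v"
    using lip \<open>0 \<le> K\<close> by (auto simp: lipschitz_on_def dist_real_def)
  ultimately show ?thesis using v01 vE vF by blast
qed

text \<open>\<open>h n\<close> is the inf-convolution of \<open>g\<close>, capped at height
  \<open>\<epsilon> + n\<close>, with the cone of slope \<open>n\<close>. The cap keeps it finite
  where \<open>g\<close> is infinite.\<close>

lemma lsc_increasing_approximation:
  fixes g :: "'a::metric_space \<Rightarrow> ereal"
  assumes lsc: "lower_semicontinuous g" and ge: "\<And>x. ereal \<epsilon> \<le> g x"
  obtains h :: "nat \<Rightarrow> 'a \<Rightarrow> real" where
    "\<And>n x y. \<bar>h n x - h n y\<bar> \<le> real n * dist x y" "\<And>n x. \<epsilon> \<le> h n x" "\<And>n x. h n x \<le> \<epsilon> + real n"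
    "\<And>n x. ereal (h n x) \<le> g x" "\<And>m n x. m \<le> n \<Longrightarrow> h m x \<le> h n x"
    "\<And>x a. ereal a < g x \<Longrightarrow> \<exists>n. a < h n x"
proof -
  \<comment> \<open>The minimum lies between \<open>\<epsilon>\<close> and the cap, so
    \<open>real_of_ereal\<close> never meets an infinite argument.\<close>
  define G where "G n y = real_of_ereal (min (g y) (ereal (\<epsilon> + real n)))" for n :: nat and y
  have G: "ereal (G n y) = min (g y) (ereal (\<epsilon> + real n))" for n y
    unfolding G_def using ge[of y] by (cases "g y") (auto simp: min_def)
  have G_ge: "\<epsilon> \<le> G n y" for n y
  proof -
    have "ereal \<epsilon> \<le> ereal (G n y)" unfolding G using ge[of y] by auto
    then show ?thesis by simp
  qed
  have G_le: "G n y \<le> \<epsilon> + real n" for n y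
  proof -
    have "ereal (G n y) \<le> ereal (\<epsilon> + real n)" unfolding G by simp
    then show ?thesis by simp
  qed
  have G_mono: "G m y \<le> G n y" if "m \<le> n" for m n y
  proof -
    have "ereal (G m y) \<le> ereal (G n y)" unfolding G using that by (intro min.mono) auto
    then show ?thesis by simp
  qed
  define h where "h n x = (INF y. G n y + real n * dist x y)" for n x
  have bdd: "bdd_below (range (\<lambda>y. G n y + real n * dist x y))" for n x
    using G_ge by (auto intro!: bdd_belowI[of _ \<epsilon>] add_increasing2)
  have h_le: "h n x \<le> G n y + real n * dist x y" for n x y
    unfolding h_def by (rule cINF_lower[OF bdd]) simp
  have h_ge: "b \<le> h n x" if "\<And>y. b \<le> G n y + real n * dist x y" for b n x
    unfolding h_def by (rule cINF_greatest) (use that in auto)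
  have h_le_G: "h n x \<le> G n x" for n x using h_le[of n x x] by simp
  have lip: "h n x \<le> h n z + real n * dist x z" for n x z
  proof -
    have "h n x - real n * dist x z \<le> h n z"
    proof (rule h_ge)
      fix y
      have "real n * dist x y \<le> real n * dist x z + real n * dist z y"
        using mult_left_mono[OF dist_triangle[of x y z], of "real n"] by (simp add: distrib_left)
      then show "h n x - real n * dist x z \<le> G n y + real n * dist z y"
        using h_le[of n x y] by linarith
    qed
    then show ?thesis by simp
  qed
  show ?thesis
  proof
    show "\<bar>h n x - h n y\<bar> \<le> real n * dist x y" for n x y
      using lip[of n x y] lip[of n y x] by (simp add: dist_commute abs_le_iff)
    show "\<epsilon> \<le> h n x" for n x
      by (rule h_ge) (use G_ge in \<open>auto intro: add_increasing2\<close>)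
    show "h n x \<le> \<epsilon> + real n" for n x
      using h_le_G G_le by (rule order_trans)
    show "ereal (h n x) \<le> g x" for n x
    proof -
      have "ereal (h n x) \<le> ereal (G n x)" using h_le_G by simp
      also have "\<dots> \<le> g x" unfolding G by simp
      finally show ?thesis .
    qed
    show "h m x \<le> h n x" if "m \<le> n" for m n x
    proof (rule h_ge)
      fix y
      have "real m * dist x y \<le> real n * dist x y" using that by (intro mult_right_mono) auto
      then show "h m x \<le> G n y + real n * dist x y"
        using h_le[of m x y] G_mono[OF that, of y] by linarith
    qed
    show "\<exists>n. a < h n x" if a: "ereal a < g x" for x a
    proof -
      obtain b where b: "a < b" "ereal b < g x" using a ereal_dense3[of "ereal a" "g x"]
        by (metis ereal_dense2 less_ereal.simps(1))
      have "open {y. ereal b < g y}" using lsc by (simp add: lower_semicontinuous_def)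
      then obtain r where r: "0 < r" "ball x r \<subseteq> {y. ereal b < g y}"
        using b openE by (metis mem_Collect_eq)
      \<comment> \<open>The second bound lifts the cap to \<open>b\<close>, for points of the ball;
        the first makes the cone reach \<open>b - \<epsilon>\<close> outside it.\<close>
      obtain n where n: "(b - \<epsilon>) / r \<le> real n" "b - \<epsilon> \<le> real n"
        using real_nat_ceiling_ge[of "max ((b - \<epsilon>) / r) (b - \<epsilon>)"] by auto
      have "b \<le> h n x"
      proof (rule h_ge)
        fix y
        show "b \<le> G n y + real n * dist x y"
        proof (cases "dist x y < r")
          case True
          then have "ereal b \<le> ereal (G n y)"
            unfolding G using r(2) n(2) by (auto simp: subset_iff less_imp_le)
          then show ?thesis by (auto intro: add_increasing2)
        next
          case False
          have "b - \<epsilon> \<le> real n * r" using n(1) r(1) by (simp add: field_simps)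
          also have "\<dots> \<le> real n * dist x y" using False by (intro mult_left_mono) auto
          finally show ?thesis using G_ge[of n y] by linarith
        qed
      qed
      then show ?thesis using b by (intro exI[of _ n]) auto
    qed
  qed
qed

section \<open>Convergence in Lebesgue spaces\<close>

lemma ennpowr_mono: "0 \<le> q \<Longrightarrow> a \<le> b \<Longrightarrow> ennpowr a q \<le> ennpowr b q"
  by (auto simp: ennpowr_def top_unique less_top intro!: ennreal_leI powr_mono2 enn2real_mono)

lemma ennpowr_eq_top_iff: "ennpowr a q = top \<longleftrightarrow> a = top"
  by (simp add: ennpowr_def)

lemma ennpowr_mult_const:
  assumes "0 < K"
  shows "ennpowr (ennreal K * a) q = ennreal (K powr q) * ennpowr a q"
proof (cases "a = \<infinity>")
  case True
  then show ?thesis using assms by (simp add: ennpowr_def ennreal_mult_top)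
next
  case False
  then have "ennreal K * a \<noteq> \<infinity>" using assms by (simp add: ennreal_mult_eq_top_iff)
  then show ?thesis
    using False assms by (simp add: ennpowr_def enn2real_mult powr_mult ennreal_mult')
qed

lemma ennpowr_tendsto_0:
  fixes f :: "'a \<Rightarrow> ennreal"
  assumes "0 < q" and "(f \<longlongrightarrow> 0) F"
  shows "((\<lambda>x. ennpowr (f x) q) \<longlongrightarrow> 0) F"
proof -
  have "\<forall>\<^sub>F x in F. f x < \<infinity>" using assms(2) by (rule order_tendstoD) simp
  moreover have "((\<lambda>x. enn2real (f x)) \<longlongrightarrow> 0) F"
    using tendsto_enn2real[of f 0 F] assms(2) by simp
  then have "((\<lambda>x. enn2real (f x) powr q) \<longlongrightarrow> 0 powr q) F"
    using assms(1) by (intro tendsto_powr' tendsto_const) auto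
  then have "((\<lambda>x. ennreal (enn2real (f x) powr q)) \<longlongrightarrow> ennreal 0) F"
    using assms(1) by (intro tendsto_ennrealI) simp
  ultimately show ?thesis
    by (auto simp: ennpowr_def elim!: Lim_transform_eventually eventually_mono)
qed

lemma borel_measurable_ennpowr [measurable]:
  assumes [measurable]: "f \<in> borel_measurable M"
  shows "(\<lambda>x. ennpowr (f x) q) \<in> borel_measurable M"
  unfolding ennpowr_def by measurable

lemma Lp_norm_finite_iff:
  "Lp_norm M p f < top \<longleftrightarrow> (\<integral>\<^sup>+x. ennpowr (e2ennreal \<bar>f x\<bar>) p \<partial>M) < top"
  unfolding Lp_norm_def using ennpowr_eq_top_iff by (metis infinity_ennreal_def less_top)

text \<open>Dominated convergence with majorant \<open>(3 * g) powr p\<close>. The factor 2 in the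
  bound on \<open>G n\<close> leaves room for approximants slightly above \<open>g\<close>, and
  pointwise convergence is required only where \<open>g\<close> is finite.\<close>

lemma tendsto_Lp_dominated:
  fixes G :: "nat \<Rightarrow> 'a \<Rightarrow> real" and g :: "'a \<Rightarrow> ereal"
  assumes "1 \<le> p" and g: "g \<in> Lp_space M p" and g_nonneg: "\<And>x. 0 \<le> g x"
    and G_meas: "\<And>n. G n \<in> borel_measurable M"
    and G_nonneg: "\<And>n x. 0 \<le> G n x" and G_le: "\<And>n x. ereal (G n x) \<le> 2 * g x"
    and lim: "\<And>x. g x < \<infinity> \<Longrightarrow> (\<lambda>n. ereal (G n x)) \<longlonglongrightarrow> g x"
  shows "tendsto_Lp M p (\<lambda>n x. ereal (G n x)) g"
proof -
  have [measurable]: "g \<in> borel_measurable M" "\<And>n. G n \<in> borel_measurable M"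
    using g G_meas by (auto simp: Lp_space_def)
  let ?I = "\<integral>\<^sup>+x. ennpowr (e2ennreal \<bar>g x\<bar>) p \<partial>M"
  have I: "?I < \<infinity>" using g by (simp add: Lp_space_def Lp_norm_finite_iff)
  have int_K: "(\<integral>\<^sup>+x. ennpowr (ennreal K * e2ennreal \<bar>g x\<bar>) p \<partial>M) < \<infinity>" if "0 < K" for K
    using I that by (simp add: ennpowr_mult_const nn_integral_cmult ennreal_mult_less_top)
  have mult_e2: "ennreal K * e2ennreal \<bar>g x\<bar> = e2ennreal (ereal K * g x)" if "0 < K" for K x
    using g_nonneg[of x] that by (cases "g x") (auto simp: e2ennreal_ereal ennreal_mult' e2ennreal_infty ennreal_mult_top)
  have e2_le: "ennpowr (e2ennreal \<bar>f\<bar>) p \<le> ennpowr (ennreal K * e2ennreal \<bar>g x\<bar>) p"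
    if "0 < K" "\<bar>f\<bar> \<le> ereal K * g x" for f K x
    using that \<open>1 \<le> p\<close> by (intro ennpowr_mono) (auto simp: mult_e2 intro: e2ennreal_mono)
  have "G n \<in> borel_measurable M \<and> Lp_norm M p (\<lambda>x. ereal (G n x)) < \<infinity>" for n
  proof -
    have "(\<integral>\<^sup>+x. ennpowr (e2ennreal \<bar>ereal (G n x)\<bar>) p \<partial>M) \<le> (\<integral>\<^sup>+x. ennpowr (ennreal 2 * e2ennreal \<bar>g x\<bar>) p \<partial>M)"
      using G_le G_nonneg by (intro nn_integral_mono e2_le) auto
    then show ?thesis using int_K[of 2] G_meas by (auto simp: Lp_norm_finite_iff)
  qed
  then have G_Lp: "(\<lambda>x. ereal (G n x)) \<in> Lp_space M p" for n
    by (auto simp: Lp_space_def)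
  have "(\<lambda>n. \<integral>\<^sup>+x. ennpowr (e2ennreal \<bar>ereal (G n x) - g x\<bar>) p \<partial>M) \<longlonglongrightarrow> (\<integral>\<^sup>+x. 0 \<partial>M)"
  proof (rule nn_integral_dominated_convergence)
    show "(\<integral>\<^sup>+x. ennpowr (ennreal 3 * e2ennreal \<bar>g x\<bar>) p \<partial>M) < \<infinity>" by (rule int_K) simp
    show "AE x in M. ennpowr (e2ennreal \<bar>ereal (G n x) - g x\<bar>) p \<le> ennpowr (ennreal 3 * e2ennreal \<bar>g x\<bar>) p" for n
    proof (rule AE_I2, rule e2_le)
      fix x
      show "\<bar>ereal (G n x) - g x\<bar> \<le> ereal 3 * g x"
        using G_nonneg[of n x] G_le[of n x] g_nonneg[of x] by (cases "g x") (auto simp: abs_le_iff)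
    qed simp
    \<comment> \<open>Integrability makes \<open>g\<close> finite almost everywhere, so the assumed
      pointwise limit applies.\<close>
    have "AE x in M. ennpowr (e2ennreal \<bar>g x\<bar>) p \<noteq> \<infinity>"
      by (rule nn_integral_PInf_AE) (use I in auto)
    then show "AE x in M. (\<lambda>n. ennpowr (e2ennreal \<bar>ereal (G n x) - g x\<bar>) p) \<longlonglongrightarrow> 0"
    proof eventually_elim
      case (elim x)
      then have fin: "g x < \<infinity>"
        using g_nonneg[of x] by (cases "g x") (auto simp: ennpowr_eq_top_iff e2ennreal_infty)
      then obtain b where b: "g x = ereal b" using g_nonneg[of x] by (cases "g x") auto
      have "(\<lambda>n. G n x) \<longlonglongrightarrow> b" using lim[OF fin] b by simp
      then have "(\<lambda>n. ennreal \<bar>G n x - b\<bar>) \<longlonglongrightarrow> ennreal \<bar>b - b\<bar>"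
        by (intro tendsto_intros)
      then have "(\<lambda>n. e2ennreal \<bar>ereal (G n x) - g x\<bar>) \<longlonglongrightarrow> 0"
        by (simp add: b e2ennreal_ereal)
      then show ?case using \<open>1 \<le> p\<close> by (intro ennpowr_tendsto_0) auto
    qed
  qed measurable
  then have "(\<lambda>n. Lp_norm M p (\<lambda>x. ereal (G n x) - g x)) \<longlonglongrightarrow> 0"
    unfolding Lp_norm_def using \<open>1 \<le> p\<close> by (intro ennpowr_tendsto_0) auto
  with G_Lp g show ?thesis by (simp add: tendsto_Lp_def)
qed

section \<open>The approximation theorem\<close>

lemma chain_cost_ge:
  fixes g :: "'a::metric_space \<Rightarrow> ereal" and h :: "nat \<Rightarrow> 'a \<Rightarrow> real"
  assumes cpt: "compact (UNIV :: 'a set)" and "closed E" "closed F" and "0 < \<epsilon>"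
    and ug: "upper_gradient g (\<lambda>x. ereal (u x))" and u: "\<And>x. x \<in> E \<Longrightarrow> u x = 0" "\<And>x. x \<in> F \<Longrightarrow> u x = 1"
    and h_cont: "\<And>n. continuous_on UNIV (h n)" and h_ge: "\<And>n x. \<epsilon> \<le> h n x"
    and h_mono: "\<And>m n x. m \<le> n \<Longrightarrow> h m x \<le> h n x" and h_lim: "\<And>x a. ereal a < g x \<Longrightarrow> \<exists>n. a < h n x"
    and "c < 1"
  shows "\<exists>m\<ge>m0. \<forall>x k. x 0 \<in> E \<longrightarrow> x k \<in> F \<longrightarrow> (\<forall>i<k. dist (x i) (x (Suc i)) < 1 / real (Suc m)) \<longrightarrow>
    c \<le> (\<Sum>i<k. h m (x i) * dist (x i) (x (Suc i)))"
proof (rule ccontr)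
  assume neg: "\<not> ?thesis"
  define cheap where "cheap n x k \<longleftrightarrow> x 0 \<in> E \<and> x k \<in> F \<and>
      (\<forall>i<k. dist (x i) (x (Suc i)) < 1 / real (Suc (m0 + n))) \<and>
      (\<Sum>i<k. h (m0 + n) (x i) * dist (x i) (x (Suc i))) < c" for n x k
  have "\<exists>x k. cheap n x k" for n
    using neg le_add1[of m0 n] unfolding cheap_def not_le[symmetric] by blast
  then obtain x k where xk: "\<And>n. cheap n (x n) (k n)" by metis
  have x: "x n 0 \<in> E" "x n (k n) \<in> F" "i < k n \<Longrightarrow> dist (x n i) (x n (Suc i)) < 1 / real (Suc (m0 + n))"
    and cost: "(\<Sum>i<k n. h (m0 + n) (x n i) * dist (x n i) (x n (Suc i))) \<le> c" for n i
    using xk[of n] by (auto simp: cheap_def)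
  have "\<exists>\<gamma>. rectifiable \<gamma> \<and> \<gamma> 0 \<in> E \<and> \<gamma> 1 \<in> F \<and> curve_integral g \<gamma> \<le> ennreal c"
  proof (rule chain_limit_curve[where x = x and k = k and h = "\<lambda>n. h (m0 + n)"
        and \<delta> = "\<lambda>n. 1 / real (Suc (m0 + n))" and A = "c / \<epsilon>"])
    have "(\<lambda>n. 1 / real (Suc (n + m0))) \<longlonglongrightarrow> 0"
      using LIMSEQ_ignore_initial_segment[OF LIMSEQ_inverse_real_of_nat, of m0]
      by (simp add: inverse_eq_divide)
    then show "(\<lambda>n. 1 / real (Suc (m0 + n))) \<longlonglongrightarrow> 0" by (simp add: add.commute)
    \<comment> \<open>The positive lower bound on \<open>h\<close> turns bounded cost into bounded
      length.\<close>
    show "(\<Sum>i<k n. dist (x n i) (x n (Suc i))) \<le> c / \<epsilon>" for n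
    proof -
      have "\<epsilon> * (\<Sum>i<k n. dist (x n i) (x n (Suc i))) \<le> (\<Sum>i<k n. h (m0 + n) (x n i) * dist (x n i) (x n (Suc i)))"
        unfolding sum_distrib_left by (intro sum_mono mult_right_mono h_ge) simp
      then show ?thesis using cost[of n] \<open>0 < \<epsilon>\<close> by (simp add: pos_le_divide_eq mult.commute)
    qed
    show "0 \<le> h (m0 + n) y" for n y
      using h_ge[of "m0 + n" y] \<open>0 < \<epsilon>\<close> by linarith
    show "\<exists>d>0. \<exists>n0. \<forall>n\<ge>n0. \<forall>y\<in>ball z d. a < h (m0 + n) y" if a: "ereal a < g z" for z a
    proof -
      obtain n0 where n0: "a < h n0 z" using h_lim[OF a] by auto
      \<comment> \<open>One continuous member exceeds \<open>a\<close> on a whole ball, and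
        monotonicity passes this on to all later members.\<close>
      have "open {y. a < h n0 y}"
        by (intro open_Collect_less continuous_intros h_cont)
      then obtain d where d: "0 < d" "ball z d \<subseteq> {y. a < h n0 y}"
        using n0 openE by (metis mem_Collect_eq)
      have "a < h (m0 + n) y" if "n0 \<le> n" "y \<in> ball z d" for n y
      proof -
        have "a < h n0 y" using d(2) that(2) by auto
        also have "\<dots> \<le> h (m0 + n) y" using that(1) by (intro h_mono) simp
        finally show ?thesis .
      qed
      then show ?thesis using d(1) by blast
    qed
    show "x n 0 \<in> E" "x n (k n) \<in> F" for n by (rule x)+
    show "i < k n \<Longrightarrow> dist (x n i) (x n (Suc i)) < 1 / real (Suc (m0 + n))" for n i by (rule x)
    show "(\<Sum>i<k n. h (m0 + n) (x n i) * dist (x n i) (x n (Suc i))) \<le> c" for n by (rule cost)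
  qed (use cpt \<open>closed E\<close> \<open>closed F\<close> in simp_all)
  then obtain \<gamma> where \<gamma>: "rectifiable \<gamma>" "\<gamma> 0 \<in> E" "\<gamma> 1 \<in> F" "curve_integral g \<gamma> \<le> ennreal c"
    by blast
  have "enn2ereal (curve_integral g \<gamma>) \<ge> \<bar>ereal (u (\<gamma> 0)) - ereal (u (\<gamma> 1))\<bar>"
    using ug \<gamma>(1) unfolding upper_gradient_def by blast
  then have "1 \<le> enn2ereal (curve_integral g \<gamma>)"
    using u(1)[OF \<gamma>(2)] u(2)[OF \<gamma>(3)] by (simp add: one_ereal_def)
  then have "1 \<le> curve_integral g \<gamma>"
    by (simp add: less_eq_ennreal.rep_eq one_ennreal.rep_eq)
  then have "1 \<le> ennreal c" using \<gamma>(4) by (rule order_trans)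
  then show False using \<open>c < 1\<close> by (simp add: ennreal_ge_1)
qed

theorem theorem3p5:
  fixes p N \<epsilon> :: real
    and E F :: "'a::metric_space set"
    and u :: "'a \<Rightarrow> real"
    and g :: "'a \<Rightarrow> ereal"
  assumes "1 \<le> p" and "1 \<le> N"
    and "compact (UNIV :: 'a set)"
    and "hausdorff_outer_measure N (UNIV :: 'a set) < \<infinity>"
    and "E \<inter> F = {}"
    and "E \<noteq> {}" and "compact E" and "connected E"
    and "F \<noteq> {}" and "compact F" and "connected F"
    and "(\<lambda>x. ereal (u x)) \<in> newtonian N p"
    and "\<forall>x\<in>E. u x = 0" and "\<forall>x\<in>F. u x = 1"
    and "lower_semicontinuous g"
    and "upper_gradient g (\<lambda>x. ereal (u x))"
    and "g \<in> Lp_space (hausdorff_measure N) p"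
    and "0 < \<epsilon>" and "\<forall>x. ereal \<epsilon> \<le> g x"
  shows "\<exists>(ui :: nat \<Rightarrow> 'a \<Rightarrow> real) (gi :: nat \<Rightarrow> 'a \<Rightarrow> real).
           (\<forall>i. (\<exists>L. L-lipschitz_on UNIV (ui i)) \<and>
                (\<forall>x. 0 \<le> ui i x \<and> ui i x \<le> 1) \<and>
                (\<forall>x\<in>E. ui i x = 0) \<and> (\<forall>x\<in>F. ui i x = 1) \<and>
                continuous_on UNIV (gi i) \<and>
                local_Lipschitz_upper_gradient (gi i) (ui i)) \<and>
           tendsto_Lp (hausdorff_measure N) p (\<lambda>i x. ereal (gi i x)) g"
proof -
  have g_ge: "ereal \<epsilon> \<le> g x" for x using assms by blast
  have g_nonneg: "0 \<le> g x" for x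
    using g_ge[of x] \<open>0 < \<epsilon>\<close> by (meson ereal_less_eq(5) less_imp_le order_trans)
  obtain h :: "nat \<Rightarrow> 'a \<Rightarrow> real" where
    h: "\<And>n x y. \<bar>h n x - h n y\<bar> \<le> real n * dist x y" "\<And>n x. \<epsilon> \<le> h n x" "\<And>n x. h n x \<le> \<epsilon> + real n"
    "\<And>n x. ereal (h n x) \<le> g x" "\<And>m n x. m \<le> n \<Longrightarrow> h m x \<le> h n x"
    "\<And>x a. ereal a < g x \<Longrightarrow> \<exists>n. a < h n x"
    using lsc_increasing_approximation[OF \<open>lower_semicontinuous g\<close> g_ge] by blast
  have h_nonneg: "0 \<le> h n x" for n x using h(2)[of n x] \<open>0 < \<epsilon>\<close> by linarith
  have h_cont: "continuous_on UNIV (h n)" for n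
    by (rule lipschitz_on_continuous_on[of "real n"]) (use h(1) in \<open>auto simp: lipschitz_on_def dist_real_def\<close>)
  \<comment> \<open>The shift by 2 gives \<open>c i \<ge> 1 / 2\<close>, so dividing by
    \<open>c i\<close> at most doubles \<open>h\<close>, as the domination by \<open>2 * g\<close>
    requires.\<close>
  define c where "c i = 1 - 1 / real (i + 2)" for i
  have c: "1 / 2 \<le> c i" "c i < 1" for i by (auto simp: c_def field_simps)
  have c_lim: "c \<longlonglongrightarrow> 1"
  proof -
    have "(\<lambda>i. 1 / real (i + 2)) \<longlonglongrightarrow> 0"
      using LIMSEQ_ignore_initial_segment[OF lim_1_over_n, of 2] by simp
    then show ?thesis unfolding c_def[abs_def] using tendsto_diff[OF tendsto_const] by fastforce
  qed
  define expensive where "expensive i m \<longleftrightarrow> (\<forall>x k. x 0 \<in> E \<longrightarrow> x k \<in> F \<longrightarrow>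
      (\<forall>j<k. dist (x j) (x (Suc j)) < 1 / real (Suc m)) \<longrightarrow>
      c i \<le> (\<Sum>j<k. h m (x j) * dist (x j) (x (Suc j))))" for i m
  \<comment> \<open>Requiring \<open>m \<ge> i\<close> lets \<open>h (m i)\<close> still increase up
    to \<open>g\<close> pointwise.\<close>
  have "\<exists>m\<ge>i. expensive i m" for i
    unfolding expensive_def using assms(13,14)
    by (intro chain_cost_ge[OF \<open>compact UNIV\<close> compact_imp_closed[OF \<open>compact E\<close>]
          compact_imp_closed[OF \<open>compact F\<close>] \<open>0 < \<epsilon>\<close> \<open>upper_gradient g _\<close> _ _ h_cont h(2,5,6) c(2)]) auto
  then obtain m where m: "\<And>i. i \<le> m i" and cost: "\<And>i. expensive i (m i)" by metis
  \<comment> \<open>Rescaling raises the minimal chain cost from \<open>c i\<close> to 1, so the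
    truncated potential is exactly 1 on \<open>F\<close>.\<close>
  define G where "G i x = h (m i) x / c i" for i x
  have "\<exists>v. (\<exists>L. L-lipschitz_on UNIV v) \<and> (\<forall>x. 0 \<le> v x \<and> v x \<le> 1) \<and>
    (\<forall>x\<in>E. v x = 0) \<and> (\<forall>x\<in>F. v x = 1) \<and> local_Lipschitz_upper_gradient (G i) v" for i
  proof (rule discrete_potential)
    have ci: "0 < c i" using c(1)[of i] by linarith
    show "0 \<le> G i y" "G i y \<le> (\<epsilon> + real (m i)) / c i" for y
      using h_nonneg h(3) ci by (auto simp: G_def intro: divide_right_mono)
    show "0 < 1 / real (Suc (m i))" by simp
    fix x k assume "x 0 \<in> E" "x k \<in> F" "\<And>j. j < k \<Longrightarrow> dist (x j) (x (Suc j)) < 1 / real (Suc (m i))"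
    then have "c i \<le> (\<Sum>j<k. h (m i) (x j) * dist (x j) (x (Suc j)))" using cost[of i] unfolding expensive_def by blast
    then show "1 \<le> (\<Sum>j<k. G i (x j) * dist (x j) (x (Suc j)))"
      using ci by (simp add: G_def sum_divide_distrib[symmetric])
  qed
  then obtain v where v: "\<And>i. (\<exists>L. L-lipschitz_on UNIV (v i)) \<and> (\<forall>x. 0 \<le> v i x \<and> v i x \<le> 1) \<and>
    (\<forall>x\<in>E. v i x = 0) \<and> (\<forall>x\<in>F. v i x = 1) \<and> local_Lipschitz_upper_gradient (G i) (v i)"
    by metis
  have G_cont: "continuous_on UNIV (G i)" for i
    unfolding G_def[abs_def] using c(1)[of i] by (intro continuous_intros h_cont) auto
  have "tendsto_Lp (hausdorff_measure N) p (\<lambda>i x. ereal (G i x)) g"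
  proof (rule tendsto_Lp_dominated[OF \<open>1 \<le> p\<close> \<open>g \<in> Lp_space _ p\<close> g_nonneg])
    show "G i \<in> borel_measurable (hausdorff_measure N)" for i
      by (intro borel_measurable_hausdorff_measure borel_measurable_continuous_onI G_cont)
    show "0 \<le> G i x" for i x using h_nonneg c(1)[of i] by (simp add: G_def)
    show "ereal (G i x) \<le> 2 * g x" for i x
    proof -
      have "h (m i) x * 1 \<le> h (m i) x * (2 * c i)"
        using h_nonneg c(1)[of i] by (intro mult_left_mono) auto
      then have "G i x \<le> 2 * h (m i) x"
        using c(1)[of i] by (simp add: G_def field_simps)
      then have "ereal (G i x) \<le> 2 * ereal (h (m i) x)" by simp
      also have "\<dots> \<le> 2 * g x" using h(4) by (intro ereal_mult_left_mono) auto
      finally show ?thesis .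
    qed
    show "(\<lambda>i. ereal (G i x)) \<longlonglongrightarrow> g x" if fin: "g x < \<infinity>" for x
    proof -
      obtain b where b: "g x = ereal b" using fin g_nonneg[of x] by (cases "g x") auto
      have "(\<lambda>i. h (m i) x) \<longlonglongrightarrow> b"
      proof (rule order_tendstoI)
        fix a assume "a < b"
        then obtain n where n: "a < h n x" using h(6)[of a x] b by auto
        show "\<forall>\<^sub>F i in sequentially. a < h (m i) x"
          using eventually_ge_at_top[of n]
        proof eventually_elim
          case (elim i)
          then show ?case using n h(5)[of n "m i" x] m[of i] by linarith
        qed
      next
        fix a assume "b < a"
        moreover have "h (m i) x \<le> b" for i using h(4)[of "m i" x] b by simp
        ultimately have "h (m i) x < a" for i by (rule le_less_trans[rotated])
        then show "\<forall>\<^sub>F i in sequentially. h (m i) x < a" by simp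
      qed
      then have "(\<lambda>i. G i x) \<longlonglongrightarrow> b / 1"
        unfolding G_def by (intro tendsto_divide c_lim) auto
      then show ?thesis by (simp add: b)
    qed
  qed
  with v G_cont show ?thesis by blast
qed

end
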